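(* Let $\mathcal{X}$ be a real vector space and $\mathcal{C}$ a family of subsets of $\mathcal{X}$ such that every $C\in\mathcal{C}$ is a symmetric, algebraically open, convex set containing $0$ for which the locally convex topology $\tau_C$ generated by $C$ is separable. Let $\tau(\mathcal{C})$ be the locally convex topology on $\mathcal{X}$ for which $\mathcal{C}_0$ is a local basis at $0$, and $\mathcal{F}(\mathcal{C})=\sigma\big(\bigcup_{x\in\mathcal{X}}\mathcal{C}_x\big)$. Let $(X_n)_{n\ge1}$ be a sequence of independent and identically distributed $(\mathcal{X},\mathcal{F}(\mathcal{C}))$-valued random variables and $\overline{X}_n=(X_1+\dots+X_n)/n$. Then $(\overline{X}_n,n)_{n\ge1}$ satisfies a weak large deviation principle, and its entropy satisfies $s=-p^*$, where $p(\lambda)=\log\mathbb{E}(e^{\lambda(X_1)})$ for $\lambda\in\mathcal{X}^*$.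
   Context: A set $C\subset\mathcal{X}$ is algebraically open if for every $x\in C$ and $y\in\mathcal{X}$ there is $\varepsilon>0$ with $x+ty\in C$ for $|t|<\varepsilon$; $\tau_C$ is the topology of the Minkowski seminorm $M_C$. For $x\in\mathcal{X}$, $\mathcal{C}_x=\{x+\bigcap_{i=1}^r\lambda_iC_i : r\ge0,\ C_i\in\mathcal{C},\ \lambda_i>0\}$ (a local basis of measurable neighborhoods of $x$). $\mathcal{X}^*$ is the dual of $(\mathcal{X},\tau(\mathcal{C}))$ (its elements are measurable, and $\overline{X}_n$ is measurable). Entropy: $s(x)=\inf_{V\in\mathcal{C}_x}\liminf_n\frac1n\log\mathbb{P}(\overline{X}_n\in V)$. $p^*(x)=\sup_{\lambda\in\mathcal{X}^*}(\lambda(x)-p(\lambda))$. Weak large deviation principle: (i) for every $G\in\mathcal{F}(\mathcal{C})$, $\liminf_n\frac1n\log\mathbb{P}(\overline{X}_n\in G)\ge\sup_{x\in\mathrm{int}\,G}s(x)$; (ii) for every relatively compact $K\in\mathcal{F}(\mathcal{C})$ (compact meaning every open cover has a finite subcover), $\limsup_n\frac1n\log\mathbb{P}(\overline{X}_n\in K)\le\sup_{x\in\overline{K}}s(x)$. *)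

theory Defs
  imports "HOL-Probability.Probability"
begin

definition symmetric_set :: "'a::real_vector set \<Rightarrow> bool" where
  "symmetric_set C \<longleftrightarrow> (\<forall>x\<in>C. - x \<in> C)"

definition alg_open :: "'a::real_vector set \<Rightarrow> bool" where
  "alg_open C \<longleftrightarrow> (\<forall>x\<in>C. \<forall>y. \<exists>\<epsilon>>0. \<forall>t::real. \<bar>t\<bar> < \<epsilon> \<longrightarrow> x + t *\<^sub>R y \<in> C)"

definition minkowski :: "'a::real_vector set \<Rightarrow> 'a \<Rightarrow> real" where
  "minkowski C x = Inf {t::real. t > 0 \<and> x \<in> (\<lambda>v. t *\<^sub>R v) ` C}"

definition tau_single :: "'a::real_vector set \<Rightarrow> 'a topology" where
  "tau_single C = topology (\<lambda>U. \<forall>x\<in>U. \<exists>r>0. {y. minkowski C (y - x) < r} \<subseteq> U)"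

definition separable_top :: "'a topology \<Rightarrow> bool" where
  "separable_top T \<longleftrightarrow> (\<exists>D. countable D \<and> D \<subseteq> topspace T \<and> T closure_of D = topspace T)"

definition Cx :: "'a::real_vector set set \<Rightarrow> 'a \<Rightarrow> 'a set set" where
  "Cx Cs x = {(\<lambda>v. x + v) ` (\<Inter>i\<in>{..<r}. (\<lambda>v. l i *\<^sub>R v) ` D i) | (r::nat) (l::nat \<Rightarrow> real) (D::nat \<Rightarrow> 'a set).
               \<forall>i<r. D i \<in> Cs \<and> l i > 0}"

definition tauC :: "'a::real_vector set set \<Rightarrow> 'a topology" where
  "tauC Cs = topology (\<lambda>U. \<forall>x\<in>U. \<exists>V\<in>Cx Cs x. V \<subseteq> U)"

definition FC :: "'a::real_vector set set \<Rightarrow> 'a measure" where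
  "FC Cs = sigma UNIV (\<Union>x. Cx Cs x)"

definition dualC :: "'a::real_vector set set \<Rightarrow> ('a \<Rightarrow> real) set" where
  "dualC Cs = {l. linear l \<and> continuous_map (tauC Cs) euclideanreal l}"

definition elog :: "real \<Rightarrow> ereal" where
  "elog p = (if p \<le> 0 then - \<infinity> else ereal (ln p))"

definition eln :: "ennreal \<Rightarrow> ereal" where
  "eln x = (if x = 0 then - \<infinity> else if x = \<infinity> then \<infinity> else ereal (ln (enn2real x)))"

definition mean :: "(nat \<Rightarrow> 'b \<Rightarrow> 'a::real_vector) \<Rightarrow> nat \<Rightarrow> 'b \<Rightarrow> 'a" where
  "mean X n \<omega> = (1 / real n) *\<^sub>R (\<Sum>i<n. X i \<omega>)"

definition rate :: "'b measure \<Rightarrow> (nat \<Rightarrow> 'b \<Rightarrow> 'a::real_vector) \<Rightarrow> 'a set \<Rightarrow> nat \<Rightarrow> ereal" where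
  "rate M X A n = ereal (1 / real n) * elog (measure M {\<omega> \<in> space M. mean X n \<omega> \<in> A})"

definition entropy :: "'a::real_vector set set \<Rightarrow> 'b measure \<Rightarrow> (nat \<Rightarrow> 'b \<Rightarrow> 'a) \<Rightarrow> 'a \<Rightarrow> ereal" where
  "entropy Cs M X x = (INF V\<in>Cx Cs x. liminf (rate M X V))"

text \<open>p(lambda) = log E exp(lambda(X_1)); X_1 is X 0 here.\<close>
definition pressure :: "'b measure \<Rightarrow> (nat \<Rightarrow> 'b \<Rightarrow> 'a::real_vector) \<Rightarrow> ('a \<Rightarrow> real) \<Rightarrow> ereal" where
  "pressure M X l = eln (\<integral>\<^sup>+ \<omega>. ennreal (exp (l (X 0 \<omega>))) \<partial>M)"

definition pstar :: "'a::real_vector set set \<Rightarrow> 'b measure \<Rightarrow> (nat \<Rightarrow> 'b \<Rightarrow> 'a) \<Rightarrow> 'a \<Rightarrow> ereal" where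
  "pstar Cs M X x = (SUP l\<in>dualC Cs. ereal (l x) - pressure M X l)"

definition weak_LDP :: "'a::real_vector set set \<Rightarrow> 'b measure \<Rightarrow> (nat \<Rightarrow> 'b \<Rightarrow> 'a) \<Rightarrow> bool" where
  "weak_LDP Cs M X \<longleftrightarrow>
     (\<forall>G\<in>sets (FC Cs).
        liminf (rate M X G) \<ge> (SUP x\<in>(tauC Cs) interior_of G. entropy Cs M X x)) \<and>
     (\<forall>K\<in>sets (FC Cs). compactin (tauC Cs) ((tauC Cs) closure_of K) \<longrightarrow>
        limsup (rate M X K) \<le> (SUP x\<in>(tauC Cs) closure_of K. entropy Cs M X x))"

end

theory Submission
  imports Defs
begin

text \<open>
  Every neighbourhood in \<open>Cx Cs x\<close> is the unit ball around \<open>x\<close> of one separable seminorm \<open>q\<close>, a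
  maximum of scaled Minkowski functionals. Independence makes the probabilities
  \<open>P(q(mean - x) < r)\<close> supermultiplicative up to an arbitrarily small loss in the radius, so
  \<open>limsup\<close> and \<open>liminf\<close> of the rates of such balls agree, and the weak large deviation principle
  follows by covering a compact closure.

  The inequality \<open>s \<le> - p*\<close> is Markov's. For \<open>s \<ge> - p*\<close>, suppose that the unit ball around
  \<open>x\<close> has rate below \<open>t < 0\<close>. The exponential rates \<open>u\<close> of balls of small radius \<open>r\<close> around \<open>y\<close>
  form a convex set of pairs \<open>(y, u)\<close> on which \<open>u - t \<le> c q(y - x)\<close> with \<open>c = 2 |t|\<close>, since
  \<open>u < t\<close> when \<open>y\<close> is close to \<open>x\<close> and \<open>u \<le> 0\<close> always. The Mazur-Orlicz theorem turns this bound
  into a continuous linear \<open>l\<close>, of norm at most \<open>c\<close>, with \<open>u + l(y) \<le> t + l(x)\<close>. As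
  \<open>p(l)\<close> is at most the supremum of \<open>u + l(y)\<close> up to an error of order \<open>c r\<close>, this gives
  \<open>p*(x) \<ge> - t\<close>. Only separability is needed in the last step, since truncating to finitely many
  small balls replaces compactness; no completeness or tightness enters.
\<close>

section \<open>Sublinear functionals\<close>

text \<open>Homogeneity is asked for only as an inequality; using it for \<open>1 / t\<close> as
  well gives equality. Infima of sublinear functionals then need one-sided estimates only.\<close>

definition sublinear :: "('a::real_vector \<Rightarrow> real) \<Rightarrow> bool" where
  "sublinear p \<longleftrightarrow> (\<forall>x y. p (x + y) \<le> p x + p y) \<and> (\<forall>t>0. \<forall>x. p (t *\<^sub>R x) \<le> t * p x)"

lemma sublinear_add: "sublinear p \<Longrightarrow> p (x + y) \<le> p x + p y"
  and sublinear_scale_le: "sublinear p \<Longrightarrow> t > 0 \<Longrightarrow> p (t *\<^sub>R x) \<le> t * p x"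
  by (auto simp: sublinear_def)

lemma sublinear_scale:
  assumes "sublinear p" "t > 0"
  shows "p (t *\<^sub>R x) = t * p x"
proof (rule antisym)
  have "p x \<le> (1 / t) * p (t *\<^sub>R x)"
    using sublinear_scale_le[OF assms(1), of "1 / t" "t *\<^sub>R x"] assms(2) by simp
  then show "t * p x \<le> p (t *\<^sub>R x)"
    using assms(2) by (simp add: field_simps)
qed (use assms sublinear_scale_le in auto)

lemma sublinear_zero: "sublinear p \<Longrightarrow> p 0 = 0"
  using sublinear_scale[of p 2 0] by simp

lemma sublinear_minus: "sublinear p \<Longrightarrow> - p (- x) \<le> p x"
  using sublinear_add[of p x "- x"] sublinear_zero[of p] by simp

text \<open>A convex cone of constraints: a pair \<open>(y, t)\<close> stands for the demand
  \<open>t \<le> f y\<close> on a linear functional \<open>f\<close>.\<close>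

definition conic :: "('a::real_vector \<times> real) set \<Rightarrow> bool" where
  "conic G \<longleftrightarrow> (0, 0) \<in> G \<and> (\<forall>y t z u. (y, t) \<in> G \<longrightarrow> (z, u) \<in> G \<longrightarrow> (y + z, t + u) \<in> G)
     \<and> (\<forall>r>0. \<forall>y t. (y, t) \<in> G \<longrightarrow> (r *\<^sub>R y, r * t) \<in> G)"

text \<open>For a conic \<open>G\<close> compatible with \<open>p\<close>, a linear \<open>f\<close>
  lies below \<open>cone_inf p G\<close> exactly when it lies below \<open>p\<close> and meets every
  constraint in \<open>G\<close>.\<close>

definition cone_inf :: "('a::real_vector \<Rightarrow> real) \<Rightarrow> ('a \<times> real) set \<Rightarrow> 'a \<Rightarrow> real" where
  "cone_inf p G x = (INF (y, t)\<in>G. p (x + y) - t)"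

context
  fixes p :: "'a::real_vector \<Rightarrow> real" and G :: "('a \<times> real) set"
  assumes p: "sublinear p" and G: "conic G" and le: "\<And>y t. (y, t) \<in> G \<Longrightarrow> t \<le> p y"
begin

text \<open>The real infimum is meaningful because
  \<open>t \<le> p y \<le> p (x + y) + p (- x)\<close>: the constraints are compatible with
  \<open>p\<close>.\<close>

lemma cone_inf_bdd: "bdd_below ((\<lambda>(y, t). p (x + y) - t) ` G)"
proof (rule bdd_belowI)
  fix v assume "v \<in> (\<lambda>(y, t). p (x + y) - t) ` G"
  then obtain y t where v: "v = p (x + y) - t" "(y, t) \<in> G" by auto
  have "p y \<le> p (x + y) + p (- x)"
    using sublinear_add[OF p, of "x + y" "- x"] by simp
  then show "- p (- x) \<le> v" using le[OF v(2)] v(1) by simp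
qed

lemma cone_inf_le: "(y, t) \<in> G \<Longrightarrow> cone_inf p G x \<le> p (x + y) - t"
  unfolding cone_inf_def by (rule order.trans[OF cINF_lower[OF cone_inf_bdd]]) auto

lemma cone_inf_ge: "(\<And>y t. (y, t) \<in> G \<Longrightarrow> v \<le> p (x + y) - t) \<Longrightarrow> v \<le> cone_inf p G x"
  unfolding cone_inf_def using G by (intro cINF_greatest) (auto simp: conic_def)

lemma cone_inf_dominated: "cone_inf p G x \<le> p x"
  using cone_inf_le[of 0 0 x] G by (simp add: conic_def)

lemma cone_inf_neg: "(y, t) \<in> G \<Longrightarrow> cone_inf p G (- y) \<le> - t"
  using cone_inf_le[of y t "- y"] sublinear_zero[OF p] by simp

text \<open>Pairs chosen for \<open>x\<close> and for \<open>y\<close> can be added or rescaled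
  inside the cone, which carries subadditivity and homogeneity of \<open>p\<close> over to the
  infimum.\<close>

lemma sublinear_cone_inf: "sublinear (cone_inf p G)"
  unfolding sublinear_def
proof (intro conjI allI impI)
  fix x y
  have "cone_inf p G (x + y) - cone_inf p G y \<le> cone_inf p G x"
  proof (rule cone_inf_ge)
    fix z t assume z: "(z, t) \<in> G"
    have "cone_inf p G (x + y) - (p (x + z) - t) \<le> cone_inf p G y"
    proof (rule cone_inf_ge)
      fix w u assume w: "(w, u) \<in> G"
      have "(z + w, t + u) \<in> G" using z w G by (auto simp: conic_def)
      from cone_inf_le[OF this, of "x + y"]
      show "cone_inf p G (x + y) - (p (x + z) - t) \<le> p (y + w) - u"
        using sublinear_add[OF p, of "x + z" "y + w"] by (simp add: algebra_simps)
    qed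
    then show "cone_inf p G (x + y) - cone_inf p G y \<le> p (x + z) - t" by simp
  qed
  then show "cone_inf p G (x + y) \<le> cone_inf p G x + cone_inf p G y" by simp
next
  fix r :: real and x assume r: "r > 0"
  have "cone_inf p G (r *\<^sub>R x) / r \<le> cone_inf p G x"
  proof (rule cone_inf_ge)
    fix z t assume z: "(z, t) \<in> G"
    then have "(r *\<^sub>R z, r * t) \<in> G" using G r by (auto simp: conic_def)
    from cone_inf_le[OF this, of "r *\<^sub>R x"]
    have "cone_inf p G (r *\<^sub>R x) \<le> r * (p (x + z) - t)"
      using sublinear_scale[OF p r, of "x + z"] by (simp add: algebra_simps)
    then show "cone_inf p G (r *\<^sub>R x) / r \<le> p (x + z) - t" using r by (simp add: field_simps)
  qed
  then show "cone_inf p G (r *\<^sub>R x) \<le> r * cone_inf p G x" using r by (simp add: field_simps)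
qed

end

text \<open>The bound by \<open>p\<close> keeps the pointwise infimum finite, since
  \<open>- p (- x) \<le> f x\<close>. For subadditivity, functionals chosen separately at
  \<open>x\<close> and \<open>y\<close> are both replaced by the smaller one, which is where the
  chain property enters.\<close>

lemma sublinear_INF_chain:
  assumes ne: "C \<noteq> {}" and sub: "\<And>f. f \<in> C \<Longrightarrow> sublinear f" and dom: "\<And>f x. f \<in> C \<Longrightarrow> f x \<le> p x"
    and chain: "\<And>f g. f \<in> C \<Longrightarrow> g \<in> C \<Longrightarrow> f \<le> g \<or> g \<le> f"
  shows "sublinear (\<lambda>x. INF f\<in>C. f x)" and "f \<in> C \<Longrightarrow> (INF f\<in>C. f x) \<le> f x"
proof -
  have bdd: "bdd_below ((\<lambda>f. f x) ` C)" for x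
  proof (rule bdd_belowI)
    fix v assume "v \<in> (\<lambda>f. f x) ` C"
    then obtain f where f: "f \<in> C" "v = f x" by auto
    show "- p (- x) \<le> v"
      using sublinear_minus[OF sub[OF f(1)], of x] dom[OF f(1), of "- x"] f(2) by simp
  qed
  have low: "(INF f\<in>C. f x) \<le> f x" if "f \<in> C" for f x
    using cINF_lower[OF bdd that] .
  then show "f \<in> C \<Longrightarrow> (INF f\<in>C. f x) \<le> f x" .
  show "sublinear (\<lambda>x. INF f\<in>C. f x)"
    unfolding sublinear_def
  proof (intro conjI allI impI)
    fix x y
    have "(INF f\<in>C. f (x + y)) - (INF f\<in>C. f y) \<le> (INF f\<in>C. f x)"
    proof (rule cINF_greatest[OF ne])
      fix f assume f: "f \<in> C"
      have "(INF f\<in>C. f (x + y)) - f x \<le> (INF f\<in>C. f y)"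
      proof (rule cINF_greatest[OF ne])
        fix g assume g: "g \<in> C"
        obtain h where h: "h \<in> C" "h \<le> f" "h \<le> g" using chain[OF f g] f g by auto
        have "(INF f\<in>C. f (x + y)) \<le> h x + h y"
          using low[OF h(1), of "x + y"] sublinear_add[OF sub[OF h(1)], of x y] by simp
        then show "(INF f\<in>C. f (x + y)) - f x \<le> g y"
          using h(2,3) by (smt (verit) le_funD)
      qed
      then show "(INF f\<in>C. f (x + y)) - (INF f\<in>C. f y) \<le> f x" by simp
    qed
    then show "(INF f\<in>C. f (x + y)) \<le> (INF f\<in>C. f x) + (INF f\<in>C. f y)" by simp
  next
    fix r :: real and x assume r: "r > 0"
    have "(INF f\<in>C. f (r *\<^sub>R x)) / r \<le> (INF f\<in>C. f x)"
    proof (rule cINF_greatest[OF ne])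
      fix f assume f: "f \<in> C"
      show "(INF f\<in>C. f (r *\<^sub>R x)) / r \<le> f x"
        using low[OF f, of "r *\<^sub>R x"] sublinear_scale[OF sub[OF f] r, of x] r
        by (simp add: field_simps)
    qed
    then show "(INF f\<in>C. f (r *\<^sub>R x)) \<le> r * (INF f\<in>C. f x)" using r by (simp add: field_simps)
  qed
qed

text \<open>Lowering \<open>m\<close> along the ray through \<open>(x, m x)\<close> by
  \<open>cone_inf\<close> gives a sublinear functional below \<open>m\<close>, hence
  \<open>m\<close> itself by minimality; its value at \<open>- x\<close> is at most
  \<open>- m x\<close>. So \<open>m\<close> is odd, and an odd sublinear functional is
  linear.\<close>

lemma minimal_sublinear_linear:
  assumes m: "sublinear m" and min: "\<And>f. sublinear f \<Longrightarrow> f \<le> m \<Longrightarrow> f = m"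
  shows "linear m"
proof -
  have neg: "m (- x) = - m x" for x
  proof -
    define G where "G = {(t *\<^sub>R x, t * m x) | t. t \<ge> 0}"
    have "(t *\<^sub>R x + u *\<^sub>R x, t * m x + u * m x) \<in> G" if "t \<ge> 0" "u \<ge> 0" for t u
      unfolding G_def using that by (auto intro!: exI[of _ "t + u"] simp: algebra_simps)
    moreover have "(r *\<^sub>R t *\<^sub>R x, r * (t * m x)) \<in> G" if "t \<ge> 0" "r > 0" for t r
      unfolding G_def using that by (auto intro!: exI[of _ "r * t"] simp: algebra_simps)
    moreover have "(0, 0) \<in> G" unfolding G_def by (auto intro!: exI[of _ 0])
    ultimately have G: "conic G" unfolding conic_def by (auto simp: G_def)
    have le: "t \<le> m y" if yt: "(y, t) \<in> G" for y t
    proof -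
      obtain s where "s \<ge> 0" "y = s *\<^sub>R x" "t = s * m x" using yt unfolding G_def by auto
      then show ?thesis
        using sublinear_scale[OF m, of s x] sublinear_zero[OF m] by (cases "s = 0") auto
    qed
    have "cone_inf m G = m"
      using sublinear_cone_inf[OF m G le] cone_inf_dominated[OF m G le]
      by (intro min) (auto simp: le_fun_def)
    moreover have "(x, m x) \<in> G" unfolding G_def by (auto intro!: exI[of _ 1])
    ultimately have "m (- x) \<le> - m x" using cone_inf_neg[OF m G le] by metis
    then show ?thesis using sublinear_minus[OF m, of "- x"] by simp
  qed
  have add: "m (x + y) = m x + m y" for x y
    using sublinear_add[OF m, of x y] sublinear_add[OF m, of "x + y" "- y"] neg[of y] by simp
  have scale: "m (r *\<^sub>R x) = r *\<^sub>R m x" for r x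
  proof (cases r "0 :: real" rule: linorder_cases)
    case less
    then show ?thesis using sublinear_scale[OF m, of "- r" x] neg[of "r *\<^sub>R x"] by simp
  qed (use sublinear_scale[OF m] sublinear_zero[OF m] in auto)
  show ?thesis using add scale by (rule linearI)
qed

section \<open>The Hahn-Banach and Mazur-Orlicz theorems\<close>

theorem Hahn_Banach_sublinear:
  assumes p: "sublinear p"
  obtains f where "linear f" "\<And>x. f x \<le> p x"
proof -
  define A where "A = {f. sublinear f \<and> f \<le> p}"
  \<comment> \<open>The order is reversed, so the maximal element supplied by Zorn's lemma is a
    minimal sublinear functional.\<close>
  let ?P = "\<lambda>f g. g \<le> (f :: 'a \<Rightarrow> real)"
  have "\<exists>m\<in>A. \<forall>a\<in>A. ?P m a \<longrightarrow> a = m"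
  proof (rule predicate_Zorn)
    show "partial_order_on A (relation_of ?P A)"
      by (auto simp: partial_order_on_def preorder_on_def refl_on_def trans_def antisym_def relation_of_def)
    fix C assume C: "C \<in> Chains (relation_of ?P A)"
    then have CA: "C \<subseteq> A" and ch: "\<And>f g. f \<in> C \<Longrightarrow> g \<in> C \<Longrightarrow> f \<le> g \<or> g \<le> f"
      by (auto simp: Chains_def relation_of_def)
    show "\<exists>u\<in>A. \<forall>a\<in>C. ?P a u"
    proof (cases "C = {}")
      case True
      then show ?thesis using p by (auto simp: A_def)
    next
      case False
      have sub: "sublinear f" and dom: "f x \<le> p x" if "f \<in> C" for f x
        using CA that by (auto simp: A_def le_fun_def)
      have inf: "sublinear (\<lambda>x. INF f\<in>C. f x)" "\<And>f x. f \<in> C \<Longrightarrow> (INF f\<in>C. f x) \<le> f x"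
        using sublinear_INF_chain[of C p] False sub dom ch by blast+
      obtain g where "g \<in> C" using False by auto
      then have "(\<lambda>x. INF f\<in>C. f x) \<in> A"
        using inf dom unfolding A_def le_fun_def by (blast intro: order.trans)
      then show ?thesis using inf(2) by (fastforce simp: le_fun_def)
    qed
  qed
  then obtain m where m: "sublinear m" "m \<le> p" and min: "\<And>f. sublinear f \<Longrightarrow> f \<le> m \<Longrightarrow> f = m"
    unfolding A_def by (auto intro: order.trans)
  show ?thesis
    using that[OF minimal_sublinear_linear[OF m(1) min]] m(2) by (simp add: le_fun_def)
qed

text \<open>By convexity the positive multiples of points of \<open>A\<close>, with the origin, form
  a cone; homogeneity of \<open>p\<close> extends the bound from \<open>A\<close> to it. A linear
  functional below \<open>cone_inf p G\<close> then respects both \<open>p\<close> and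
  \<open>A\<close>.\<close>

theorem Mazur_Orlicz:
  assumes p: "sublinear p" and A: "convex A" and le: "\<And>y t. (y, t) \<in> A \<Longrightarrow> t \<le> p y"
  obtains f where "linear f" "\<And>x. f x \<le> p x" "\<And>y t. (y, t) \<in> A \<Longrightarrow> t \<le> f y"
proof -
  define G where "G = insert (0, 0) {(r *\<^sub>R y, r * t) | r y t. r > 0 \<and> (y, t) \<in> A}"
  have add: "(r *\<^sub>R y + s *\<^sub>R z, r * t + s * u) \<in> G"
    if "r > 0" "s > 0" "(y, t) \<in> A" "(z, u) \<in> A" for r s :: real and y z t u
  proof -
    have "(r / (r + s)) *\<^sub>R (y, t) + (s / (r + s)) *\<^sub>R (z, u) \<in> A"
      using that by (intro convexD[OF A]) (auto simp flip: add_divide_distrib)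
    then have "((r / (r + s)) *\<^sub>R y + (s / (r + s)) *\<^sub>R z, (r / (r + s)) * t + (s / (r + s)) * u) \<in> A"
      by simp
    moreover have "r *\<^sub>R y + s *\<^sub>R z = (r + s) *\<^sub>R ((r / (r + s)) *\<^sub>R y + (s / (r + s)) *\<^sub>R z)"
      "r * t + s * u = (r + s) * ((r / (r + s)) * t + (s / (r + s)) * u)"
      using that by (simp_all add: scaleR_add_right distrib_left)
    moreover have "r + s > 0" using that by simp
    ultimately show ?thesis unfolding G_def by blast
  qed
  have scale: "(r *\<^sub>R s *\<^sub>R y, r * (s * t)) \<in> G" if "r > 0" "s > 0" "(y, t) \<in> A" for r s :: real and y t
  proof -
    have "r *\<^sub>R s *\<^sub>R y = (r * s) *\<^sub>R y" "r * (s * t) = (r * s) * t" "r * s > 0" using that by auto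
    then show ?thesis using that(3) unfolding G_def by blast
  qed
  have G: "conic G"
    unfolding conic_def
  proof (intro conjI allI impI)
    fix y t z u assume "(y, t) \<in> G" "(z, u) \<in> G"
    then show "(y + z, t + u) \<in> G"
      using add unfolding G_def by (elim insertE CollectE exE conjE) auto
  next
    fix r :: real and y t assume "r > 0" "(y, t) \<in> G"
    then consider "y = 0" "t = 0" | s z u where "s > 0" "(z, u) \<in> A" "y = s *\<^sub>R z" "t = s * u"
      unfolding G_def by blast
    then show "(r *\<^sub>R y, r * t) \<in> G"
    proof cases
      case 2
      then show ?thesis using scale[OF \<open>r > 0\<close> 2(1,2)] by simp
    qed (simp add: G_def)
  qed (simp add: G_def)
  have le': "t \<le> p y" if "(y, t) \<in> G" for y t
    using that le sublinear_scale[OF p] sublinear_zero[OF p] unfolding G_def by auto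
  obtain f where f: "linear f" "\<And>x. f x \<le> cone_inf p G x"
    using Hahn_Banach_sublinear[OF sublinear_cone_inf[OF p G le']] by blast
  have "f x \<le> p x" for x
    using f(2)[of x] cone_inf_dominated[OF p G le', of x] by simp
  moreover have "t \<le> f y" if "(y, t) \<in> A" for y t
  proof -
    have "(1 *\<^sub>R y, 1 * t) \<in> G"
      unfolding G_def using that zero_less_one[where 'a = real] by blast
    then have "(y, t) \<in> G" by simp
    then have "f (- y) \<le> - t" using f(2)[of "- y"] cone_inf_neg[OF p G le'] by force
    then show ?thesis using linear_neg[OF f(1), of y] by simp
  qed
  ultimately show ?thesis using that f(1) by blast
qed

section \<open>Admissible seminorms\<close>

text \<open>Nonnegativity follows from \<open>0 = q (x - x) \<le> 2 * q x\<close>.\<close>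

definition seminorm :: "('a::real_vector \<Rightarrow> real) \<Rightarrow> bool" where
  "seminorm q \<longleftrightarrow> (\<forall>x y. q (x + y) \<le> q x + q y) \<and> (\<forall>r x. q (r *\<^sub>R x) = \<bar>r\<bar> * q x)"

lemma seminorm_scale: "seminorm q \<Longrightarrow> q (r *\<^sub>R x) = \<bar>r\<bar> * q x"
  and seminorm_add: "seminorm q \<Longrightarrow> q (x + y) \<le> q x + q y"
  by (auto simp: seminorm_def)

lemma seminorm_zero: "seminorm q \<Longrightarrow> q 0 = 0"
  using seminorm_scale[of q 0 0] by simp

lemma seminorm_minus: "seminorm q \<Longrightarrow> q (- x) = q x"
  using seminorm_scale[of q "-1" x] by simp

lemma seminorm_diff_commute: "seminorm q \<Longrightarrow> q (x - y) = q (y - x)"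
  using seminorm_minus[of q "x - y"] by simp

lemma seminorm_triangle: "seminorm q \<Longrightarrow> q (x - z) \<le> q (x - y) + q (y - z)"
  using seminorm_add[of q "x - y" "y - z"] by simp

lemma seminorm_diff: "seminorm q \<Longrightarrow> q (x - y) \<le> q x + q y"
  using seminorm_add[of q x "- y"] seminorm_minus[of q y] by simp

lemma seminorm_nonneg: "seminorm q \<Longrightarrow> 0 \<le> q x"
  using seminorm_diff[of q x x] seminorm_zero[of q] by simp

lemma seminorm_sum: "seminorm q \<Longrightarrow> q (\<Sum>i\<in>I. f i) \<le> (\<Sum>i\<in>I. q (f i))"
proof (induction I rule: infinite_finite_induct)
  case (insert i I)
  then show ?case using seminorm_add[of q "f i" "\<Sum>i\<in>I. f i"] by simp
qed (auto simp: seminorm_zero)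

definition separable_seminorm :: "('a::real_vector \<Rightarrow> real) \<Rightarrow> bool" where
  "separable_seminorm q \<longleftrightarrow> (\<exists>D. countable D \<and> (\<forall>x. \<forall>e>0. \<exists>d\<in>D. q (x - d) < e))"

text \<open>A dense point \<open>a\<close> near \<open>x\<close> for \<open>p\<close> and a dense
  point \<open>b\<close> near \<open>x\<close> for \<open>q\<close> may differ, so a common
  approximation is selected for every triple \<open>(a, b, n)\<close> that admits one.\<close>

lemma separable_seminorm_max:
  assumes p: "seminorm p" "separable_seminorm p" and q: "seminorm q" "separable_seminorm q"
  shows "separable_seminorm (\<lambda>x. max (p x) (q x))"
proof -
  obtain A where A: "countable A" "\<And>x e. e > 0 \<Longrightarrow> \<exists>d\<in>A. p (x - d) < e"
    using p unfolding separable_seminorm_def by blast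
  obtain B where B: "countable B" "\<And>x e. e > 0 \<Longrightarrow> \<exists>d\<in>B. q (x - d) < e"
    using q unfolding separable_seminorm_def by blast
  define g where "g = (\<lambda>(a, b, n::nat). SOME z. p (z - a) < 1 / Suc n \<and> q (z - b) < 1 / Suc n)"
  let ?D = "g ` (A \<times> B \<times> UNIV)"
  have "\<exists>d\<in>?D. max (p (x - d)) (q (x - d)) < e" if "e > 0" for x e
  proof -
    obtain n where n: "1 / Suc n < e / 2"
      using nat_approx_posE[of "e / 2"] \<open>e > 0\<close> by auto
    obtain a b where ab: "a \<in> A" "p (x - a) < 1 / Suc n" "b \<in> B" "q (x - b) < 1 / Suc n"
      using A(2)[of "1 / Suc n" x] B(2)[of "1 / Suc n" x] by auto
    define z where "z = g (a, b, n)"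
    \<comment> \<open>The point \<open>x\<close> itself witnesses that this triple admits a
      choice.\<close>
    have "p (z - a) < 1 / Suc n \<and> q (z - b) < 1 / Suc n"
      unfolding z_def g_def prod.case by (rule someI[of _ x]) (use ab in auto)
    then have "p (x - z) < e" "q (x - z) < e"
      using seminorm_triangle[OF p(1), of x z a] seminorm_triangle[OF q(1), of x z b] ab n
        seminorm_diff_commute[OF p(1), of z a] seminorm_diff_commute[OF q(1), of z b] by linarith+
    moreover have "z \<in> ?D" unfolding z_def using ab by blast
    ultimately show ?thesis by auto
  qed
  moreover have "countable ?D" using A(1) B(1) by auto
  ultimately show ?thesis unfolding separable_seminorm_def by blast
qed

text \<open>Requiring every ball to be literally a member of \<open>Cx Cs x\<close> makes balls
  available both as basic neighbourhoods and as generators of \<open>FC Cs\<close>.\<close>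

definition admissible :: "'a::real_vector set set \<Rightarrow> ('a \<Rightarrow> real) \<Rightarrow> bool" where
  "admissible Cs q \<longleftrightarrow> seminorm q \<and> separable_seminorm q \<and> (\<forall>x. \<forall>r>0. {y. q (y - x) < r} \<in> Cx Cs x)"

section \<open>Basic neighbourhoods and the topologies they generate\<close>

lemma Cx_UNIV: "UNIV \<in> Cx Cs x"
proof -
  have eq: "UNIV = (\<lambda>v. x + v) ` (\<Inter>i\<in>{..<0::nat}. (\<lambda>v. (1::real) *\<^sub>R v) ` UNIV)"
    by (simp add: surj_plus)
  show ?thesis
    unfolding Cx_def
    by (intro CollectI exI[of _ "0::nat"] exI[of _ "\<lambda>_. 1"] exI[of _ "\<lambda>_. UNIV"] conjI eq) simp
qed

lemma Cx_Int:
  assumes "V \<in> Cx Cs x" "W \<in> Cx Cs x"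
  shows "V \<inter> W \<in> Cx Cs x"
proof -
  obtain r l D where V: "V = (\<lambda>v. x + v) ` (\<Inter>i\<in>{..<r::nat}. (\<lambda>v. l i *\<^sub>R v) ` D i)"
    "\<And>i. i < r \<Longrightarrow> D i \<in> Cs \<and> l i > 0"
    using assms(1) unfolding Cx_def by blast
  obtain s k E where W: "W = (\<lambda>v. x + v) ` (\<Inter>i\<in>{..<s::nat}. (\<lambda>v. k i *\<^sub>R v) ` E i)"
    "\<And>i. i < s \<Longrightarrow> E i \<in> Cs \<and> k i > 0"
    using assms(2) unfolding Cx_def by blast
  \<comment> \<open>The two families of factors and sets are concatenated, the second one shifted by
    \<open>r\<close>.\<close>
  define m where "m i = (if i < r then l i else k (i - r))" for i
  define F where "F i = (if i < r then D i else E (i - r))" for i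
  have "(\<Inter>i\<in>{..<r + s}. (\<lambda>v. m i *\<^sub>R v) ` F i) = (\<Inter>i\<in>{..<r}. (\<lambda>v. l i *\<^sub>R v) ` D i) \<inter> (\<Inter>i\<in>{..<s}. (\<lambda>v. k i *\<^sub>R v) ` E i)"
    (is "?A = ?B \<inter> ?C")
  proof -
    have "{..<r + s} = {..<r} \<union> (+) r ` {..<s}"
      by (auto simp: lessThan_atLeast0 add.commute)
    then have "?A = (\<Inter>i\<in>{..<r}. (\<lambda>v. m i *\<^sub>R v) ` F i) \<inter> (\<Inter>i\<in>{..<s}. (\<lambda>v. m (r + i) *\<^sub>R v) ` F (r + i))"
      by (simp only: INT_Un INF_image o_def)
    also have "\<dots> = ?B \<inter> ?C" by (simp add: m_def F_def)
    finally show ?thesis .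
  qed
  then have "V \<inter> W = (\<lambda>v. x + v) ` (\<Inter>i\<in>{..<r + s}. (\<lambda>v. m i *\<^sub>R v) ` F i)"
    unfolding V(1) W(1) by (simp add: image_Int)
  moreover have "\<forall>i<r + s. F i \<in> Cs \<and> m i > 0"
    using V(2) W(2) by (auto simp: m_def F_def)
  ultimately show ?thesis
    unfolding Cx_def by (intro CollectI exI[of _ "r + s"] exI[of _ m] exI[of _ F] conjI) simp_all
qed

lemma admissible_zero: "admissible Cs (\<lambda>_. 0)"
  unfolding admissible_def seminorm_def separable_seminorm_def
  by (auto simp: Cx_UNIV intro!: exI[of _ "{0}"])

lemma admissible_max:
  assumes "admissible Cs p" "admissible Cs q"
  shows "admissible Cs (\<lambda>x. max (p x) (q x))"
  unfolding admissible_def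
proof (intro conjI allI impI)
  have pq: "seminorm p" "seminorm q" using assms by (auto simp: admissible_def)
  show "seminorm (\<lambda>x. max (p x) (q x))"
    unfolding seminorm_def
  proof (intro conjI allI)
    fix x y show "max (p (x + y)) (q (x + y)) \<le> max (p x) (q x) + max (p y) (q y)"
      using seminorm_add[OF pq(1), of x y] seminorm_add[OF pq(2), of x y] by linarith
  qed (simp add: seminorm_scale[OF pq(1)] seminorm_scale[OF pq(2)] max_mult_distrib_left)
  show "separable_seminorm (\<lambda>x. max (p x) (q x))"
    using assms by (intro separable_seminorm_max) (auto simp: admissible_def)
next
  fix x and r :: real assume "r > 0"
  then have "{y. p (y - x) < r} \<inter> {y. q (y - x) < r} \<in> Cx Cs x"
    using assms by (intro Cx_Int) (auto simp: admissible_def)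
  moreover have "{y. p (y - x) < r} \<inter> {y. q (y - x) < r} = {y. max (p (y - x)) (q (y - x)) < r}"
    by auto
  ultimately show "{y. max (p (y - x)) (q (y - x)) < r} \<in> Cx Cs x" by metis
qed

text \<open>\<open>topology\<close> returns the intended open sets only once its predicate is known
  to be a topology; this covers \<open>tauC\<close> and \<open>tau_single\<close> at once.\<close>

lemma istopology_ball_base:
  assumes "\<And>x V W. V \<in> B x \<Longrightarrow> W \<in> B x \<Longrightarrow> \<exists>U\<in>B x. U \<subseteq> V \<inter> W"
  shows "istopology (\<lambda>U. \<forall>x\<in>U. \<exists>V\<in>B x. V \<subseteq> U)"
  unfolding istopology_def
proof (intro conjI allI impI ballI)
  fix S T x assume *: "\<forall>x\<in>S. \<exists>V\<in>B x. V \<subseteq> S" "\<forall>x\<in>T. \<exists>V\<in>B x. V \<subseteq> T" "x \<in> S \<inter> T"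
  then obtain V W where VW: "V \<in> B x" "V \<subseteq> S" "W \<in> B x" "W \<subseteq> T" by blast
  then obtain U where "U \<in> B x" "U \<subseteq> V \<inter> W" using assms by blast
  then show "\<exists>V\<in>B x. V \<subseteq> S \<inter> T" using VW by blast
next
  fix K x assume "\<forall>S\<in>K. \<forall>x\<in>S. \<exists>V\<in>B x. V \<subseteq> S" "x \<in> \<Union>K"
  then obtain S V where "S \<in> K" "V \<in> B x" "V \<subseteq> S" by blast
  then show "\<exists>V\<in>B x. V \<subseteq> \<Union>K" by blast
qed

lemma openin_tauC: "openin (tauC Cs) U \<longleftrightarrow> (\<forall>x\<in>U. \<exists>V\<in>Cx Cs x. V \<subseteq> U)"
proof -
  have "istopology (\<lambda>U. \<forall>x\<in>U. \<exists>V\<in>Cx Cs x. V \<subseteq> U)"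
    by (rule istopology_ball_base) (meson Cx_Int order.refl)
  then show ?thesis unfolding tauC_def by (simp add: topology_inverse')
qed

lemma openin_tau_single:
  "openin (tau_single C) U \<longleftrightarrow> (\<forall>x\<in>U. \<exists>r>0. {y. minkowski C (y - x) < r} \<subseteq> U)"
proof -
  let ?B = "\<lambda>x. {{y. minkowski C (y - x) < r} | r. r > 0}"
  have eq: "(\<exists>r>0. {y. minkowski C (y - x) < r} \<subseteq> U) \<longleftrightarrow> (\<exists>V\<in>?B x. V \<subseteq> U)" for x U
    by blast
  have "istopology (\<lambda>U. \<forall>x\<in>U. \<exists>V\<in>?B x. V \<subseteq> U)"
  proof (rule istopology_ball_base)
    fix x V W assume "V \<in> ?B x" "W \<in> ?B x"
    then obtain r s where rs: "V = {y. minkowski C (y - x) < r}" "W = {y. minkowski C (y - x) < s}"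
      "r > 0" "s > 0" by blast
    then have "{y. minkowski C (y - x) < min r s} \<subseteq> V \<inter> W" "min r s > 0" by auto
    then show "\<exists>U\<in>?B x. U \<subseteq> V \<inter> W" by blast
  qed
  then show ?thesis unfolding tau_single_def eq by (simp only: topology_inverse')
qed

lemma topspace_tauC [simp]: "topspace (tauC Cs) = UNIV"
  using openin_subset[of "tauC Cs" UNIV] Cx_UNIV by (auto simp: openin_tauC)

lemma topspace_tau_single [simp]: "topspace (tau_single C) = UNIV"
proof -
  have "openin (tau_single C) UNIV"
    by (auto simp: openin_tau_single intro!: exI[of _ 1])
  then show ?thesis using openin_subset by blast
qed

section \<open>Minkowski functionals of algebraically open discs\<close>

locale disc =
  fixes C :: "'a::real_vector set"
  assumes sym: "symmetric_set C" and alg: "alg_open C" and conv: "convex C" and zero: "0 \<in> C"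
begin

lemma scaled_mem_mono:
  assumes "(1 / s) *\<^sub>R x \<in> C" "0 < s" "s \<le> t"
  shows "(1 / t) *\<^sub>R x \<in> C"
proof -
  have "(s / t) *\<^sub>R ((1 / s) *\<^sub>R x) + (1 - s / t) *\<^sub>R 0 \<in> C"
    using assms by (intro convexD[OF conv] zero) auto
  then show ?thesis using assms by simp
qed

lemma minkowski_alt: "minkowski C x = Inf {t. t > 0 \<and> (1 / t) *\<^sub>R x \<in> C}"
proof -
  have "x \<in> (\<lambda>v. t *\<^sub>R v) ` C \<longleftrightarrow> (1 / t) *\<^sub>R x \<in> C" if "t > 0" for t :: real
  proof
    assume "(1 / t) *\<^sub>R x \<in> C"
    then have "t *\<^sub>R (1 / t) *\<^sub>R x \<in> (\<lambda>v. t *\<^sub>R v) ` C" by blast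
    then show "x \<in> (\<lambda>v. t *\<^sub>R v) ` C" using that by simp
  qed (use that in auto)
  then show ?thesis unfolding minkowski_def by (metis (lifting))
qed

lemma absorbing: obtains t where "t > 0" "(1 / t) *\<^sub>R x \<in> C"
proof -
  obtain e where e: "e > 0" "\<And>t. \<bar>t\<bar> < e \<Longrightarrow> 0 + t *\<^sub>R x \<in> C"
    using alg zero unfolding alg_open_def by metis
  have "0 + (e / 2) *\<^sub>R x \<in> C" using e(1) by (intro e(2)) auto
  then show ?thesis using e(1) by (intro that[of "2 / e"]) auto
qed

text \<open>Algebraic openness lets the point \<open>x / t\<close> of \<open>C\<close> be pushed
  outwards a little along its ray, so the infimum is strictly below \<open>t\<close>. Hence
  \<open>C\<close> is exactly the open unit ball of its Minkowski functional.\<close>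

lemma minkowski_less_iff:
  assumes "t > 0"
  shows "minkowski C x < t \<longleftrightarrow> (1 / t) *\<^sub>R x \<in> C"
proof
  assume "minkowski C x < t"
  moreover have "{t. t > 0 \<and> (1 / t) *\<^sub>R x \<in> C} \<noteq> {}" using absorbing[of x] by blast
  ultimately have "\<exists>s\<in>{t. t > 0 \<and> (1 / t) *\<^sub>R x \<in> C}. s < t"
    unfolding minkowski_alt by (intro cInf_lessD)
  then obtain s where "s > 0" "(1 / s) *\<^sub>R x \<in> C" "s < t" by auto
  then show "(1 / t) *\<^sub>R x \<in> C" using scaled_mem_mono[of s x t] by simp
next
  assume *: "(1 / t) *\<^sub>R x \<in> C"
  then obtain e where e: "e > 0" "\<And>r. \<bar>r\<bar> < e \<Longrightarrow> (1 / t) *\<^sub>R x + r *\<^sub>R ((1 / t) *\<^sub>R x) \<in> C"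
    using alg unfolding alg_open_def by metis
  \<comment> \<open>Chosen so that \<open>1 / s = (1 + e / 2) / t\<close>.\<close>
  define s where "s = t / (1 + e / 2)"
  have s: "0 < s" "s < t" unfolding s_def using assms e(1) by (auto simp: field_simps)
  have "(1 / t) *\<^sub>R x + (e / 2) *\<^sub>R ((1 / t) *\<^sub>R x) \<in> C" using e(1) by (intro e(2)) auto
  moreover have "(1 / t) *\<^sub>R x + (e / 2) *\<^sub>R ((1 / t) *\<^sub>R x) = (1 / s) *\<^sub>R x"
  proof -
    have "1 / t + e / 2 * (1 / t) = 1 / s" unfolding s_def using assms e(1) by (simp add: field_simps)
    then show ?thesis by (simp flip: scaleR_add_left)
  qed
  ultimately have "s \<in> {t. t > 0 \<and> (1 / t) *\<^sub>R x \<in> C}" using s by simp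
  then have "minkowski C x \<le> s"
    unfolding minkowski_alt by (intro cInf_lower) (auto intro!: bdd_belowI[of _ 0])
  then show "minkowski C x < t" using s by simp
qed

lemma minkowski_nonneg: "0 \<le> minkowski C x"
  unfolding minkowski_alt using absorbing[of x] by (intro cInf_greatest) force+

lemma seminorm_minkowski: "seminorm (minkowski C)"
  unfolding seminorm_def
proof (intro conjI allI)
  fix x y
  show "minkowski C (x + y) \<le> minkowski C x + minkowski C y"
  proof (rule field_le_epsilon)
    fix e :: real assume e: "e > 0"
    define s t where "s = minkowski C x + e / 2" and "t = minkowski C y + e / 2"
    have st: "s > 0" "t > 0" using e minkowski_nonneg[of x] minkowski_nonneg[of y] by (auto simp: s_def t_def)
    have "(1 / s) *\<^sub>R x \<in> C" "(1 / t) *\<^sub>R y \<in> C"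
      using st e by (auto simp flip: minkowski_less_iff simp: s_def t_def)
    then have "(s / (s + t)) *\<^sub>R (1 / s) *\<^sub>R x + (t / (s + t)) *\<^sub>R (1 / t) *\<^sub>R y \<in> C"
      using st by (intro convexD[OF conv]) (auto simp flip: add_divide_distrib)
    then have "(1 / (s + t)) *\<^sub>R (x + y) \<in> C" using st by (simp add: scaleR_add_right)
    then have "minkowski C (x + y) < s + t" using st by (simp add: minkowski_less_iff)
    then show "minkowski C (x + y) \<le> minkowski C x + minkowski C y + e" by (simp add: s_def t_def)
  qed
next
  fix r :: real and x
  have le: "minkowski C (r *\<^sub>R x) \<le> \<bar>r\<bar> * minkowski C x" for r x
  proof (rule field_le_epsilon)
    fix e :: real assume e: "e > 0"
    \<comment> \<open>The denominator \<open>\<bar>r\<bar> + 1\<close> bounds the error after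
      multiplication by \<open>\<bar>r\<bar>\<close> and stays positive for
      \<open>r = 0\<close>.\<close>
    define s where "s = minkowski C x + e / (\<bar>r\<bar> + 1)"
    have s: "s > 0" "minkowski C x < s" using e minkowski_nonneg[of x] by (auto simp: s_def add_nonneg_pos)
    then have *: "(1 / s) *\<^sub>R x \<in> C" by (simp add: minkowski_less_iff)
    have "minkowski C (r *\<^sub>R x) \<le> \<bar>r\<bar> * s"
    proof (cases "r = 0")
      case True
      have "minkowski C 0 < d" if "d > 0" for d using that zero by (simp add: minkowski_less_iff)
      then have "minkowski C 0 \<le> 0" by (meson dense_ge less_imp_le)
      then show ?thesis using True by simp
    next
      case False
      have "- ((1 / s) *\<^sub>R x) \<in> C" using sym * by (simp add: symmetric_set_def)
      moreover have "(1 / (\<bar>r\<bar> * s)) *\<^sub>R (r *\<^sub>R x) = (if r > 0 then (1 / s) *\<^sub>R x else - ((1 / s) *\<^sub>R x))"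
        using False by auto
      ultimately have "(1 / (\<bar>r\<bar> * s)) *\<^sub>R (r *\<^sub>R x) \<in> C"
        using * by presburger
      then have "minkowski C (r *\<^sub>R x) < \<bar>r\<bar> * s" using s False by (simp add: minkowski_less_iff)
      then show ?thesis by simp
    qed
    also have "\<dots> \<le> \<bar>r\<bar> * minkowski C x + e"
    proof -
      have "\<bar>r\<bar> * (e / (\<bar>r\<bar> + 1)) \<le> e" using e by (simp add: pos_divide_le_eq)
      then show ?thesis by (simp add: s_def distrib_left)
    qed
    finally show "minkowski C (r *\<^sub>R x) \<le> \<bar>r\<bar> * minkowski C x + e" .
  qed
  show "minkowski C (r *\<^sub>R x) = \<bar>r\<bar> * minkowski C x"
  proof (cases "r = 0")
    case True
    then show ?thesis using le[of 0 x] minkowski_nonneg[of 0] by simp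
  next
    case False
    \<comment> \<open>The reverse inequality is the upper bound applied to \<open>1 / r\<close> and
      \<open>r *\<^sub>R x\<close>.\<close>
    then have "minkowski C x \<le> minkowski C (r *\<^sub>R x) / \<bar>r\<bar>"
      using le[of "1 / r" "r *\<^sub>R x"] by simp
    then have "\<bar>r\<bar> * minkowski C x \<le> minkowski C (r *\<^sub>R x)"
      using False by (subst (asm) pos_le_divide_eq) (auto simp: mult.commute)
    then show ?thesis using le[of r x] by simp
  qed
qed

lemma separable_minkowski:
  assumes "separable_top (tau_single C)"
  shows "separable_seminorm (minkowski C)"
proof -
  obtain D where D: "countable D" "tau_single C closure_of D = UNIV"
    using assms unfolding separable_top_def topspace_tau_single by blast
  have "\<exists>d\<in>D. minkowski C (x - d) < e" if "e > 0" for x e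
  proof -
    have "openin (tau_single C) {y. minkowski C (y - x) < e}"
      unfolding openin_tau_single
    proof (intro ballI)
      fix y assume y: "y \<in> {y. minkowski C (y - x) < e}"
      then show "\<exists>r>0. {z. minkowski C (z - y) < r} \<subseteq> {y. minkowski C (y - x) < e}"
      proof (intro exI[of _ "e - minkowski C (y - x)"] conjI subsetI CollectI)
        fix z assume "z \<in> {z. minkowski C (z - y) < e - minkowski C (y - x)}"
        then show "minkowski C (z - x) < e"
          using seminorm_triangle[OF seminorm_minkowski, of z x y] by simp
      qed simp
    qed
    moreover have "x \<in> {y. minkowski C (y - x) < e}" using that zero by (simp add: minkowski_less_iff)
    moreover have "\<forall>T. x \<in> T \<and> openin (tau_single C) T \<longrightarrow> (\<exists>y. y \<in> D \<and> y \<in> T)"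
      using D(2) in_closure_of[of x "tau_single C" D] by simp
    ultimately obtain d where "d \<in> D" "minkowski C (d - x) < e" by (metis (lifting) mem_Collect_eq)
    then show ?thesis using seminorm_diff_commute[OF seminorm_minkowski, of x d] by (intro bexI[of _ d]) simp_all
  qed
  then show ?thesis using D(1) unfolding separable_seminorm_def by blast
qed

lemma minkowski_ball:
  assumes "r > 0"
  shows "{y. minkowski C (y - x) < r} = (\<lambda>v. x + v) ` (\<lambda>v. r *\<^sub>R v) ` C"
proof (intro equalityI subsetI)
  fix y assume "y \<in> {y. minkowski C (y - x) < r}"
  then have "(1 / r) *\<^sub>R (y - x) \<in> C" using assms by (simp add: minkowski_less_iff)
  moreover have "y = x + r *\<^sub>R ((1 / r) *\<^sub>R (y - x))" using assms by simp
  ultimately show "y \<in> (\<lambda>v. x + v) ` (\<lambda>v. r *\<^sub>R v) ` C" by blast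
qed (use assms in \<open>auto simp: minkowski_less_iff\<close>)

text \<open>Dividing by \<open>l\<close> gives the gauge of \<open>l C\<close>, whose balls are
  translates of a single scaled set, the case \<open>r = 1\<close> in \<open>Cx\<close>.\<close>

lemma admissible_minkowski:
  assumes "C \<in> Cs" "separable_top (tau_single C)" "l > 0"
  shows "admissible Cs (\<lambda>x. minkowski C x / l)"
  unfolding admissible_def
proof (intro conjI allI impI)
  show "seminorm (\<lambda>x. minkowski C x / l)"
    unfolding seminorm_def
    using seminorm_add[OF seminorm_minkowski] assms(3)
    by (auto simp: seminorm_scale[OF seminorm_minkowski] divide_right_mono simp flip: add_divide_distrib)
  obtain D where D: "countable D" "\<And>x e. e > 0 \<Longrightarrow> \<exists>d\<in>D. minkowski C (x - d) < e"
    using separable_minkowski[OF assms(2)] unfolding separable_seminorm_def by blast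
  have "\<exists>d\<in>D. minkowski C (x - d) / l < e" if "e > 0" for x e
    using D(2)[of "e * l" x] that assms(3) by (auto simp: field_simps)
  then show "separable_seminorm (\<lambda>x. minkowski C x / l)"
    using D(1) unfolding separable_seminorm_def by blast
next
  fix x and r :: real assume r: "r > 0"
  have "{y. minkowski C (y - x) / l < r} = {y. minkowski C (y - x) < r * l}"
    using assms(3) by (simp add: field_simps)
  also have "\<dots> = (\<lambda>v. x + v) ` (\<lambda>v. (r * l) *\<^sub>R v) ` C"
    using r assms(3) by (simp add: minkowski_ball)
  also have "\<dots> = (\<lambda>v. x + v) ` (\<Inter>i\<in>{..<1::nat}. (\<lambda>v. (r * l) *\<^sub>R v) ` C)"
    by (simp add: lessThan_Suc)
  finally have eq: "{y. minkowski C (y - x) / l < r} = (\<lambda>v. x + v) ` (\<Inter>i\<in>{..<1::nat}. (\<lambda>v. (r * l) *\<^sub>R v) ` C)" .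
  show "{y. minkowski C (y - x) / l < r} \<in> Cx Cs x"
    unfolding Cx_def
    by (intro CollectI exI[of _ "1::nat"] exI[of _ "\<lambda>_. r * l"] exI[of _ "\<lambda>_. C"] conjI eq)
      (use r assms in auto)
qed

end

text \<open>Induction over the intersected sets, adjoining one gauge at a time by a maximum; the
  whole space is the unit ball of the zero seminorm. Later arguments thus handle one seminorm rather
  than a finite family.\<close>

lemma Cx_seminorm_ball:
  assumes hC: "\<And>C. C \<in> Cs \<Longrightarrow> symmetric_set C \<and> alg_open C \<and> convex C \<and> 0 \<in> C \<and> separable_top (tau_single C)"
    and V: "V \<in> Cx Cs x"
  obtains q where "admissible Cs q" "V = {y. q (y - x) < 1}"
proof -
  obtain r l D where V: "V = (\<lambda>v. x + v) ` (\<Inter>i\<in>{..<r::nat}. (\<lambda>v. l i *\<^sub>R v) ` D i)"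
    and lD: "\<And>i. i < r \<Longrightarrow> D i \<in> Cs \<and> l i > 0"
    using V unfolding Cx_def by blast
  have "\<exists>q. admissible Cs q \<and> (\<Inter>i\<in>{..<r}. (\<lambda>v. l i *\<^sub>R v) ` D i) = {v. q v < 1}"
    using lD
  proof (induction r)
    case 0
    show ?case using admissible_zero by (intro exI[of _ "\<lambda>_. 0"]) auto
  next
    case (Suc r)
    then obtain q where q: "admissible Cs q" "(\<Inter>i\<in>{..<r}. (\<lambda>v. l i *\<^sub>R v) ` D i) = {v. q v < 1}"
      by auto
    interpret disc "D r" using hC Suc.prems[of r] by unfold_locales auto
    have l: "l r > 0" and D: "D r \<in> Cs" using Suc.prems by auto
    have "{v. minkowski (D r) v / l r < 1} = (\<lambda>v. l r *\<^sub>R v) ` D r"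
      using minkowski_ball[OF l, of 0] l by (simp add: field_simps)
    then have "(\<Inter>i\<in>{..<Suc r}. (\<lambda>v. l i *\<^sub>R v) ` D i) = {v. max (minkowski (D r) v / l r) (q v) < 1}"
      using q(2) by (auto simp: lessThan_Suc)
    then show ?case using admissible_max[OF admissible_minkowski[OF D _ l] q(1)] hC[OF D] by metis
  qed
  then obtain q where q: "admissible Cs q" "(\<Inter>i\<in>{..<r}. (\<lambda>v. l i *\<^sub>R v) ` D i) = {v. q v < 1}"
    by blast
  have "V = {y. q (y - x) < 1}"
    unfolding V q(2) by (auto simp: image_iff intro!: exI[of _ "_ - x"])
  then show ?thesis using that q(1) by blast
qed

section \<open>Measurability\<close>

lemma space_FC [simp]: "space (FC Cs) = UNIV"
  by (simp add: FC_def)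

lemma Cx_sets_FC: "V \<in> Cx Cs x \<Longrightarrow> V \<in> sets (FC Cs)"
  by (auto simp: FC_def)

locale disc_family =
  fixes Cs :: "'a::real_vector set set"
  assumes hC: "\<And>C. C \<in> Cs \<Longrightarrow> symmetric_set C \<and> alg_open C \<and> convex C \<and> 0 \<in> C \<and> separable_top (tau_single C)"
begin

text \<open>It suffices to test the generators of \<open>FC Cs\<close>, and each of them is a unit
  ball of an admissible seminorm.\<close>

lemma measurable_FC_iff:
  "f \<in> measurable N (FC Cs) \<longleftrightarrow>
    (\<forall>q x r. admissible Cs q \<longrightarrow> r > 0 \<longrightarrow> {\<omega>\<in>space N. q (f \<omega> - x) < r} \<in> sets N)"
proof (intro iffI allI impI)
  fix q x and r :: real assume f: "f \<in> measurable N (FC Cs)" "admissible Cs q" "r > 0"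
  then have "{y. q (y - x) < r} \<in> sets (FC Cs)"
    by (intro Cx_sets_FC[of _ _ x]) (auto simp: admissible_def)
  from measurable_sets[OF f(1) this]
  show "{\<omega>\<in>space N. q (f \<omega> - x) < r} \<in> sets N"
    by (simp add: vimage_def Int_def conj_commute)
next
  assume *: "\<forall>q x r. admissible Cs q \<longrightarrow> r > 0 \<longrightarrow> {\<omega>\<in>space N. q (f \<omega> - x) < r} \<in> sets N"
  show "f \<in> measurable N (FC Cs)"
    unfolding FC_def
  proof (rule measurable_sigma_sets[where \<Omega> = UNIV and A = "\<Union>x. Cx Cs x"])
    fix V assume "V \<in> (\<Union>x. Cx Cs x)"
    then obtain x where "V \<in> Cx Cs x" by blast
    then obtain q where q: "admissible Cs q" "V = {y. q (y - x) < 1}"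
      using Cx_seminorm_ball hC by blast
    have "f -` V \<inter> space N = {\<omega>\<in>space N. q (f \<omega> - x) < 1}" using q(2) by auto
    then show "f -` V \<inter> space N \<in> sets N" using * q(1) by simp
  qed (auto simp: sets_measure_of)
qed

lemma measurable_FC_scale:
  assumes "f \<in> measurable N (FC Cs)"
  shows "(\<lambda>\<omega>. c *\<^sub>R f \<omega>) \<in> measurable N (FC Cs)"
proof (cases "c = 0")
  case False
  show ?thesis
    unfolding measurable_FC_iff
  proof (intro allI impI)
    fix q x and r :: real assume q: "admissible Cs q" and r: "r > 0"
    have sq: "seminorm q" using q by (simp add: admissible_def)
    have "q (c *\<^sub>R v - x) = \<bar>c\<bar> * q (v - (1 / c) *\<^sub>R x)" for v
      using seminorm_scale[OF sq, of c "v - (1 / c) *\<^sub>R x"] False by (simp add: scaleR_diff_right)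
    then have "{\<omega>\<in>space N. q (c *\<^sub>R f \<omega> - x) < r} = {\<omega>\<in>space N. q (f \<omega> - (1 / c) *\<^sub>R x) < r / \<bar>c\<bar>}"
      using False by (simp add: field_simps)
    also have "\<dots> \<in> sets N"
      using assms q r False unfolding measurable_FC_iff by auto
    finally show "{\<omega>\<in>space N. q (c *\<^sub>R f \<omega> - x) < r} \<in> sets N" .
  qed
qed simp

text \<open>Separability turns the sum event into a countable union of rectangles.\<close>

lemma measurable_FC_add:
  assumes f: "f \<in> measurable N (FC Cs)" and g: "g \<in> measurable N (FC Cs)"
  shows "(\<lambda>\<omega>. f \<omega> + g \<omega>) \<in> measurable N (FC Cs)"
  unfolding measurable_FC_iff
proof (intro allI impI)
  fix q x and r :: real assume q: "admissible Cs q" and r: "r > 0"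
  have sq: "seminorm q" using q by (simp add: admissible_def)
  obtain D where D: "countable D" "\<And>x e. e > 0 \<Longrightarrow> \<exists>d\<in>D. q (x - d) < e"
    using q unfolding admissible_def separable_seminorm_def by blast
  \<comment> \<open>A small ball for \<open>f\<close> around \<open>d\<close>, with the rest of the
    radius left for \<open>g\<close>; the case distinction keeps that rest positive, as
    \<open>measurable_FC_iff\<close> asks.\<close>
  let ?E = "\<lambda>d n. {\<omega>\<in>space N. q (f \<omega> - d) < 1 / Suc n} \<inter> (if 1 / Suc n < r then {\<omega>\<in>space N. q (g \<omega> - (x - d)) < r - 1 / Suc n} else {})"
  have "{\<omega>\<in>space N. q (f \<omega> + g \<omega> - x) < r} = (\<Union>d\<in>D. \<Union>n. ?E d n)"
  proof (intro equalityI subsetI)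
    fix \<omega> assume "\<omega> \<in> {\<omega>\<in>space N. q (f \<omega> + g \<omega> - x) < r}"
    then have w: "\<omega> \<in> space N" "q (f \<omega> + g \<omega> - x) < r" by auto
    \<comment> \<open>Half of the slack, because \<open>1 / Suc n\<close> is lost both in passing
      from \<open>f\<close> to \<open>d\<close> and in the reduced radius.\<close>
    obtain n where n: "1 / Suc n < (r - q (f \<omega> + g \<omega> - x)) / 2"
      using nat_approx_posE[of "(r - q (f \<omega> + g \<omega> - x)) / 2"] w(2) by auto
    obtain d where d: "d \<in> D" "q (f \<omega> - d) < 1 / Suc n" using D(2)[of "1 / Suc n" "f \<omega>"] by auto
    have "q (g \<omega> - (x - d)) \<le> q (f \<omega> + g \<omega> - x) + q (d - f \<omega>)"
      using seminorm_add[OF sq, of "f \<omega> + g \<omega> - x" "d - f \<omega>"] by (simp add: algebra_simps)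
    then have "q (g \<omega> - (x - d)) < q (f \<omega> + g \<omega> - x) + 1 / Suc n"
      using d seminorm_diff_commute[OF sq, of d "f \<omega>"] by simp
    then have "q (g \<omega> - (x - d)) < r - 1 / Suc n"
      using n by (simp add: field_simps)
    moreover have "(r - q (f \<omega> + g \<omega> - x)) / 2 \<le> r"
      using seminorm_nonneg[OF sq, of "f \<omega> + g \<omega> - x"] r by simp
    with n have "1 / Suc n < r" by simp
    ultimately have "\<omega> \<in> ?E d n" using w d by simp
    then show "\<omega> \<in> (\<Union>d\<in>D. \<Union>n. ?E d n)" using d(1) by blast
  next
    fix \<omega> assume "\<omega> \<in> (\<Union>d\<in>D. \<Union>n. ?E d n)"
    then obtain d n where "\<omega> \<in> ?E d n" by blast
    then have w: "\<omega> \<in> space N" "q (f \<omega> - d) < 1 / Suc n" "q (g \<omega> - (x - d)) < r - 1 / Suc n"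
      by (auto split: if_splits)
    have "q (f \<omega> + g \<omega> - x) \<le> q (f \<omega> - d) + q (g \<omega> - (x - d))"
      using seminorm_add[OF sq, of "f \<omega> - d" "g \<omega> - (x - d)"] by (simp add: algebra_simps)
    then show "\<omega> \<in> {\<omega>\<in>space N. q (f \<omega> + g \<omega> - x) < r}" using w by simp
  qed
  moreover have "?E d n \<in> sets N" for d n
    using f g q unfolding measurable_FC_iff by auto
  ultimately show "{\<omega>\<in>space N. q (f \<omega> + g \<omega> - x) < r} \<in> sets N"
    using D(1) by (simp add: sets.countable_UN'')
qed

lemma measurable_FC_sum:
  assumes "\<And>i. i \<in> I \<Longrightarrow> f i \<in> measurable N (FC Cs)"
  shows "(\<lambda>\<omega>. \<Sum>i\<in>I. f i \<omega>) \<in> measurable N (FC Cs)"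
  using assms
proof (induction I rule: infinite_finite_induct)
  case (insert i I)
  then show ?case using measurable_FC_add[of "f i" N "\<lambda>\<omega>. \<Sum>i\<in>I. f i \<omega>"] by simp
qed auto

section \<open>Continuous linear functionals\<close>

lemma dualC_dominated:
  assumes "l \<in> dualC Cs"
  obtains q where "admissible Cs q" "\<And>x. \<bar>l x\<bar> \<le> q x"
proof -
  have lin: "linear l" and cont: "continuous_map (tauC Cs) euclideanreal l"
    using assms by (auto simp: dualC_def)
  have "openin (tauC Cs) {x. l x \<in> {-1<..<1}}"
    using openin_continuous_map_preimage[OF cont, of "{-1<..<1}"] by simp
  moreover have "0 \<in> {x. l x \<in> {-1<..<1}}" using linear_0[OF lin] by simp
  \<comment> \<open>Continuity at \<open>0\<close> gives a basic neighbourhood on which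
    \<open>\<bar>l\<bar>\<close> stays below 1; its gauge then dominates \<open>l\<close> by
    homogeneity.\<close>
  ultimately obtain V where V: "V \<in> Cx Cs 0" "V \<subseteq> {x. l x \<in> {-1<..<1}}"
    unfolding openin_tauC by blast
  obtain q where q: "admissible Cs q" "V = {y. q (y - 0) < 1}"
    using Cx_seminorm_ball[OF hC V(1)] by blast
  have sq: "seminorm q" using q by (simp add: admissible_def)
  have "\<bar>l x\<bar> \<le> q x" for x
  proof (rule field_le_epsilon)
    fix e :: real assume e: "e > 0"
    define s where "s = q x + e"
    have s: "s > 0" using e seminorm_nonneg[OF sq, of x] by (simp add: s_def)
    have "q ((1 / s) *\<^sub>R x) < 1" using s e by (simp add: seminorm_scale[OF sq] s_def)
    then have "l ((1 / s) *\<^sub>R x) \<in> {-1<..<1}" using V(2) q(2) by auto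
    then have "\<bar>l x / s\<bar> < 1" using linear_cmul[OF lin, of "1 / s" x] by auto
    then show "\<bar>l x\<bar> \<le> q x + e" using s by (simp add: s_def field_simps)
  qed
  then show ?thesis using that q(1) by blast
qed

lemma dominated_dualC:
  assumes q: "admissible Cs q" and lin: "linear l" and c: "c > 0" and le: "\<And>x. \<bar>l x\<bar> \<le> c * q x"
  shows "l \<in> dualC Cs"
proof -
  have "openin (tauC Cs) {x. l x \<in> U}" if "open U" for U
    unfolding openin_tauC
  proof
    fix x assume "x \<in> {x. l x \<in> U}"
    then obtain e where e: "e > 0" "\<And>t. \<bar>t - l x\<bar> < e \<Longrightarrow> t \<in> U"
      using \<open>open U\<close> unfolding open_dist by (auto simp: dist_real_def)
    have "{y. q (y - x) < e / c} \<subseteq> {x. l x \<in> U}"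
    proof
      fix y assume "y \<in> {y. q (y - x) < e / c}"
      then have "c * q (y - x) < e" using c by (simp add: field_simps)
      then have "\<bar>l y - l x\<bar> < e"
        using le[of "y - x"] linear_diff[OF lin, of y x] by simp
      then show "y \<in> {x. l x \<in> U}" using e(2) by simp
    qed
    moreover have "{y. q (y - x) < e / c} \<in> Cx Cs x" using q e c by (simp add: admissible_def)
    ultimately show "\<exists>V\<in>Cx Cs x. V \<subseteq> {x. l x \<in> U}" by blast
  qed
  then show ?thesis using lin by (simp add: dualC_def continuous_map_def)
qed

text \<open>With \<open>l\<close> dominated by a separable \<open>q\<close>, the half-space
  \<open>{x. a < l x}\<close> is a countable union of \<open>q\<close>-balls around points
  \<open>d\<close> of a dense set at which \<open>l\<close> exceeds \<open>a\<close> by more than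
  the radius.\<close>

lemma measurable_dualC:
  assumes "l \<in> dualC Cs"
  shows "l \<in> borel_measurable (FC Cs)"
proof -
  obtain q where q: "admissible Cs q" "\<And>x. \<bar>l x\<bar> \<le> q x" using dualC_dominated[OF assms] by blast
  have lin: "linear l" using assms by (auto simp: dualC_def)
  obtain D where D: "countable D" "\<And>x e. e > 0 \<Longrightarrow> \<exists>d\<in>D. q (x - d) < e"
    using q(1) unfolding admissible_def separable_seminorm_def by blast
  have diff: "\<bar>l x - l d\<bar> \<le> q (x - d)" for x d using q(2)[of "x - d"] linear_diff[OF lin, of x d] by simp
  show ?thesis
  proof (rule borel_measurable_iff_greater[THEN iffD2], intro allI)
    fix a
    let ?I = "{(d, n). d \<in> D \<and> l d > a + 1 / Suc n}"
    have "{x. a < l x} = (\<Union>(d, n)\<in>?I. {y. q (y - d) < 1 / Suc n})"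
    proof (intro equalityI subsetI)
      fix x assume x: "x \<in> {x. a < l x}"
      then obtain n where n: "1 / Suc n < (l x - a) / 2"
        using nat_approx_posE[of "(l x - a) / 2"] by auto
      obtain d where d: "d \<in> D" "q (x - d) < 1 / Suc n" using D(2)[of "1 / Suc n" x] by auto
      have "l d > l x - 1 / Suc n" using diff[of x d] d by simp
      then have "l d > a + 1 / Suc n" using n by (simp add: field_simps)
      then show "x \<in> (\<Union>(d, n)\<in>?I. {y. q (y - d) < 1 / Suc n})" using d by blast
    next
      fix x assume "x \<in> (\<Union>(d, n)\<in>?I. {y. q (y - d) < 1 / Suc n})"
      then obtain d n where "l d > a + 1 / Suc n" "q (x - d) < 1 / Suc n" by blast
      then show "x \<in> {x. a < l x}" using diff[of x d] by simp
    qed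
    moreover have "countable ?I"
      by (rule countable_subset[of _ "D \<times> UNIV"]) (use D(1) in auto)
    moreover have "{y. q (y - d) < 1 / Suc n} \<in> sets (FC Cs)" for d n
      using q(1) by (intro Cx_sets_FC[of _ _ d]) (auto simp: admissible_def)
    ultimately show "{x \<in> space (FC Cs). a < l x} \<in> sets (FC Cs)"
      by (auto intro!: sets.countable_UN'')
  qed
qed

end

section \<open>Independent sums\<close>

locale iid_sequence = disc_family Cs + prob_space M
  for Cs :: "'a::real_vector set set" and M :: "'b measure" +
  fixes X :: "nat \<Rightarrow> 'b \<Rightarrow> 'a"
  assumes hX: "\<And>i. X i \<in> measurable M (FC Cs)"
    and hind: "indep_vars (\<lambda>_. FC Cs) X UNIV"
    and hid: "\<And>i. distr M (FC Cs) (X i) = distr M (FC Cs) (X 0)"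
begin

lemma measurable_mean: "mean X n \<in> measurable M (FC Cs)"
  unfolding mean_def[abs_def] by (intro measurable_FC_scale measurable_FC_sum hX)

lemma mean_event:
  assumes "G \<in> sets (FC Cs)"
  shows "{\<omega>\<in>space M. mean X n \<omega> \<in> G} \<in> sets M"
  using measurable_sets[OF measurable_mean assms] by (simp add: vimage_def Int_def conj_commute)

text \<open>Disjoint blocks of coordinates are independent, and a block sum is a measurable function
  of its block.\<close>

lemma indep_block_sums:
  assumes "I \<inter> J = {}"
  shows "indep_var (FC Cs) (\<lambda>\<omega>. \<Sum>i\<in>I. X i \<omega>) (FC Cs) (\<lambda>\<omega>. \<Sum>i\<in>J. X i \<omega>)"
proof -
  have sum: "(\<lambda>f. \<Sum>i\<in>K. f i) \<in> measurable (PiM K (\<lambda>_. FC Cs)) (FC Cs)" for K :: "nat set"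
    by (intro measurable_FC_sum measurable_component_singleton)
  have "indep_var (FC Cs) ((\<lambda>f. \<Sum>i\<in>I. f i) \<circ> (\<lambda>\<omega>. restrict (\<lambda>i. X i \<omega>) I))
      (FC Cs) ((\<lambda>f. \<Sum>i\<in>J. f i) \<circ> (\<lambda>\<omega>. restrict (\<lambda>i. X i \<omega>) J))"
    by (rule indep_var_compose[OF indep_var_restrict[OF hind assms] sum sum]) auto
  then show ?thesis by (simp add: o_def)
qed

text \<open>The law of a block is the image under addition of the product of the law of the block
  without its last variable and the law of \<open>X 0\<close>; this recursion does not see where the
  block starts.\<close>

lemma distr_block_sum:
  "distr M (FC Cs) (\<lambda>\<omega>. \<Sum>i\<in>{m..<m + n}. X i \<omega>) = distr M (FC Cs) (\<lambda>\<omega>. \<Sum>i<n. X i \<omega>)"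
proof (induction n)
  case (Suc n)
  have "distr M (FC Cs) (\<lambda>\<omega>. \<Sum>i\<in>{k..<k + Suc n}. X i \<omega>)
      = distr (distr M (FC Cs) (\<lambda>\<omega>. \<Sum>i\<in>{k..<k + n}. X i \<omega>) \<Otimes>\<^sub>M distr M (FC Cs) (X 0)) (FC Cs) (\<lambda>(x, y). x + y)"
    for k
  proof -
    have meas: "(\<lambda>\<omega>. \<Sum>i\<in>I. X i \<omega>) \<in> measurable M (FC Cs)" for I
      by (intro measurable_FC_sum hX)
    \<comment> \<open>Measurability of addition on the product sigma-algebra rests on
      \<open>measurable_FC_add\<close>, hence on separability.\<close>
    have plus: "(\<lambda>(x, y). x + y) \<in> measurable (FC Cs \<Otimes>\<^sub>M FC Cs) (FC Cs)"
      unfolding case_prod_beta by (intro measurable_FC_add measurable_fst measurable_snd)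
    have "indep_var (FC Cs) (\<lambda>\<omega>. \<Sum>i\<in>{k..<k + n}. X i \<omega>) (FC Cs) (\<lambda>\<omega>. \<Sum>i\<in>{k + n}. X i \<omega>)"
      by (rule indep_block_sums) auto
    then have "distr M (FC Cs) (\<lambda>\<omega>. \<Sum>i\<in>{k..<k + n}. X i \<omega>) \<Otimes>\<^sub>M distr M (FC Cs) (X (k + n))
        = distr M (FC Cs \<Otimes>\<^sub>M FC Cs) (\<lambda>\<omega>. (\<Sum>i\<in>{k..<k + n}. X i \<omega>, X (k + n) \<omega>))"
      unfolding indep_var_distribution_eq by simp
    moreover have "distr (distr M (FC Cs \<Otimes>\<^sub>M FC Cs) (\<lambda>\<omega>. (\<Sum>i\<in>{k..<k + n}. X i \<omega>, X (k + n) \<omega>))) (FC Cs) (\<lambda>(x, y). x + y)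
        = distr M (FC Cs) (\<lambda>\<omega>. \<Sum>i\<in>{k..<k + Suc n}. X i \<omega>)"
      using meas hX by (subst distr_distr[OF plus]) (auto simp: o_def intro!: measurable_Pair)
    ultimately show ?thesis using hid[of "k + n"] by simp
  qed
  from this[of m] this[of 0] show ?case using Suc.IH by (simp add: lessThan_atLeast0)
qed simp

lemma prob_block_sum:
  assumes "G \<in> sets (FC Cs)"
  shows "prob {\<omega>\<in>space M. (\<Sum>i\<in>{m..<m + n}. X i \<omega>) \<in> G} = prob {\<omega>\<in>space M. (\<Sum>i<n. X i \<omega>) \<in> G}"
proof -
  have "measure (distr M (FC Cs) (\<lambda>\<omega>. \<Sum>i\<in>I. X i \<omega>)) G = prob {\<omega>\<in>space M. (\<Sum>i\<in>I. X i \<omega>) \<in> G}" for I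
    by (subst measure_distr[OF measurable_FC_sum[OF hX] assms]) (simp add: vimage_def Int_def conj_commute)
  from this[of "{m..<m + n}"] this[of "{..<n}"] show ?thesis using distr_block_sum[of m n] by simp
qed

text \<open>The first \<open>m\<close> and the next \<open>n\<close> variables form independent
  blocks, and the second block sum has the law of the sum of the first \<open>n\<close>
  variables.\<close>

lemma prob_sum_split:
  assumes "G \<in> sets (FC Cs)" "H \<in> sets (FC Cs)"
    and "K \<in> sets (FC Cs)" "\<And>x y. x \<in> G \<Longrightarrow> y \<in> H \<Longrightarrow> x + y \<in> K"
  shows "prob {\<omega>\<in>space M. (\<Sum>i<m. X i \<omega>) \<in> G} * prob {\<omega>\<in>space M. (\<Sum>i<n. X i \<omega>) \<in> H}
      \<le> prob {\<omega>\<in>space M. (\<Sum>i<m + n. X i \<omega>) \<in> K}"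
proof -
  let ?S = "\<lambda>\<omega>. \<Sum>i<m. X i \<omega>" and ?T = "\<lambda>\<omega>. \<Sum>i\<in>{m..<m + n}. X i \<omega>"
  have ind: "indep_var (FC Cs) ?S (FC Cs) ?T" by (rule indep_block_sums) auto
  have eq: "(\<Sum>i<m + n. X i \<omega>) = ?S \<omega> + ?T \<omega>" for \<omega>
    by (subst sum.union_disjoint[symmetric]) (auto intro!: arg_cong2[where f = sum])
  have meas: "(\<lambda>\<omega>. \<Sum>i<m + n. X i \<omega>) \<in> measurable M (FC Cs)" by (intro measurable_FC_sum hX)
  have "prob {\<omega>\<in>space M. ?S \<omega> \<in> G} * prob {\<omega>\<in>space M. (\<Sum>i<n. X i \<omega>) \<in> H}
      = prob {\<omega>\<in>space M. ?S \<omega> \<in> G} * prob {\<omega>\<in>space M. ?T \<omega> \<in> H}"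
    using prob_block_sum[OF assms(2), of m n] by simp
  also have "\<dots> = prob ((\<lambda>\<omega>. (?S \<omega>, ?T \<omega>)) -` (G \<times> H) \<inter> space M)"
    using indep_varD[OF ind assms(1,2)] by (simp add: vimage_def Int_def conj_commute)
  also have "\<dots> \<le> prob {\<omega>\<in>space M. (\<Sum>i<m + n. X i \<omega>) \<in> K}"
  proof (rule finite_measure_mono)
    show "(\<lambda>\<omega>. (?S \<omega>, ?T \<omega>)) -` (G \<times> H) \<inter> space M \<subseteq> {\<omega>\<in>space M. (\<Sum>i<m + n. X i \<omega>) \<in> K}"
      using assms(4) eq by auto
    show "{\<omega>\<in>space M. (\<Sum>i<m + n. X i \<omega>) \<in> K} \<in> events"
      using measurable_sets[OF meas assms(3)] by (simp add: vimage_def Int_def conj_commute)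
  qed
  finally show ?thesis .
qed

text \<open>With \<open>h\<close> a truncated exponential this is the multiplicativity of the moment generating function.\<close>

lemma nn_integral_prod_iid:
  fixes h :: "'a \<Rightarrow> ennreal"
  assumes h: "h \<in> borel_measurable (FC Cs)"
  shows "(\<integral>\<^sup>+\<omega>. (\<Prod>i<n. h (X i \<omega>)) \<partial>M) = (\<integral>\<^sup>+\<omega>. h (X 0 \<omega>) \<partial>M) ^ n"
proof -
  have same: "(\<integral>\<^sup>+\<omega>. h (X i \<omega>) \<partial>M) = (\<integral>\<^sup>+\<omega>. h (X 0 \<omega>) \<partial>M)" for i
    using nn_integral_distr[OF hX, of h i] nn_integral_distr[OF hX, of h 0] hid[of i] h by simp
  have "indep_vars (\<lambda>_. borel) (\<lambda>i \<omega>. h (X i \<omega>)) {..<n}"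
    using indep_vars_compose2[OF indep_vars_subset[OF hind subset_UNIV], of "{..<n}" "\<lambda>_. h" "\<lambda>_. borel"] h
    by simp
  then have "(\<integral>\<^sup>+\<omega>. (\<Prod>i<n. h (X i \<omega>)) \<partial>M) = (\<Prod>i<n. \<integral>\<^sup>+\<omega>. h (X i \<omega>) \<partial>M)"
    using indep_vars_nn_integral[of "{..<n}" "\<lambda>i \<omega>. h (X i \<omega>)"] by simp
  also have "\<dots> = (\<Prod>i<n. \<integral>\<^sup>+\<omega>. h (X 0 \<omega>) \<partial>M)"
    by (rule prod.cong[OF refl same])
  finally show ?thesis by simp
qed

section \<open>Exponential rates\<close>

text \<open>Thresholds on the rate become thresholds on the probability, which hides the value
  \<open>- \<infinity>\<close> of \<open>elog\<close>. For \<open>n = 0\<close> the rate is 0 by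
  \<open>1 / 0 = 0\<close>, so that index is excluded.\<close>

lemma rate_ge_iff:
  assumes "n > 0"
  shows "ereal a \<le> rate M X A n \<longleftrightarrow> exp (real n * a) \<le> prob {\<omega>\<in>space M. mean X n \<omega> \<in> A}"
proof -
  define p where "p = prob {\<omega>\<in>space M. mean X n \<omega> \<in> A}"
  show ?thesis
  proof (cases "p \<le> 0")
    case True
    have "\<not> exp (real n * a) \<le> p" using True by (meson exp_gt_zero not_le order.trans)
    then show ?thesis
      using True assms by (simp add: rate_def elog_def p_def[symmetric])
  next
    case False
    have "a \<le> ln p / n \<longleftrightarrow> real n * a \<le> ln p" using assms by (simp add: field_simps)
    also have "\<dots> \<longleftrightarrow> exp (real n * a) \<le> p" using False by (simp add: ln_ge_iff)
    finally show ?thesis using False assms by (simp add: rate_def elog_def p_def[symmetric])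
  qed
qed

lemma rate_less_iff:
  "n > 0 \<Longrightarrow> rate M X A n < ereal a \<longleftrightarrow> prob {\<omega>\<in>space M. mean X n \<omega> \<in> A} < exp (real n * a)"
  using rate_ge_iff[of n a A] by (metis not_le)

lemma rate_le_iff:
  assumes "n > 0"
  shows "rate M X A n \<le> ereal a \<longleftrightarrow> prob {\<omega>\<in>space M. mean X n \<omega> \<in> A} \<le> exp (real n * a)"
proof -
  define p where "p = prob {\<omega>\<in>space M. mean X n \<omega> \<in> A}"
  show ?thesis
  proof (cases "p \<le> 0")
    case True
    have "p \<le> exp (real n * a)" using True by (meson exp_ge_zero order.trans)
    then show ?thesis
      using True assms by (simp add: rate_def elog_def p_def[symmetric])
  next
    case False
    have "ln p / n \<le> a \<longleftrightarrow> ln p \<le> real n * a" using assms by (simp add: field_simps)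
    also have "\<dots> \<longleftrightarrow> exp (ln p) \<le> exp (real n * a)" by simp
    also have "\<dots> \<longleftrightarrow> p \<le> exp (real n * a)" using False by simp
    finally show ?thesis using False assms by (simp add: rate_def elog_def p_def[symmetric])
  qed
qed

text \<open>A constant factor \<open>c\<close> does not affect an exponential rate: for each
  \<open>b < a\<close> it is absorbed as soon as \<open>n * (a - b) \<ge> - ln c\<close>.\<close>

lemma liminf_rate_ge:
  assumes c: "c > 0" and ev: "\<forall>\<^sub>F n in sequentially. c * exp (real n * a) \<le> prob {\<omega>\<in>space M. mean X n \<omega> \<in> A}"
  shows "ereal a \<le> liminf (rate M X A)"
proof (rule ccontr)
  assume "\<not> ereal a \<le> liminf (rate M X A)"
  then obtain b where b: "liminf (rate M X A) < ereal b" "b < a"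
    using ereal_dense2[of "liminf (rate M X A)" "ereal a"] by (auto simp: not_le)
  have "\<forall>\<^sub>F n in sequentially. - ln c / (a - b) \<le> real n"
    by (rule eventually_sequentiallyI[of "nat \<lceil>- ln c / (a - b)\<rceil>"]) linarith
  then have "\<forall>\<^sub>F n in sequentially. ereal b \<le> rate M X A n"
    using ev eventually_gt_at_top[of 0]
  proof eventually_elim
    case (elim n)
    have "real n * b \<le> ln c + real n * a" using elim(1) b(2) by (simp add: field_simps)
    then have "exp (real n * b) \<le> c * exp (real n * a)"
      using c by (metis exp_add exp_le_cancel_iff exp_ln)
    then show ?case using elim by (simp add: rate_ge_iff)
  qed
  then have "ereal b \<le> liminf (rate M X A)" by (rule Liminf_bounded)
  then show False using b(1) by simp
qed

lemma limsup_rate_le: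
  assumes c: "c > 0" and ev: "\<forall>\<^sub>F n in sequentially. prob {\<omega>\<in>space M. mean X n \<omega> \<in> A} \<le> c * exp (real n * a)"
  shows "limsup (rate M X A) \<le> ereal a"
proof (rule ccontr)
  assume "\<not> limsup (rate M X A) \<le> ereal a"
  then obtain b where b: "ereal b < limsup (rate M X A)" "a < b"
    using ereal_dense2[of "ereal a" "limsup (rate M X A)"] by (auto simp: not_le)
  have "\<forall>\<^sub>F n in sequentially. ln c / (b - a) \<le> real n"
    by (rule eventually_sequentiallyI[of "nat \<lceil>ln c / (b - a)\<rceil>"]) linarith
  then have "\<forall>\<^sub>F n in sequentially. rate M X A n \<le> ereal b"
    using ev eventually_gt_at_top[of 0]
  proof eventually_elim
    case (elim n)
    have "ln c + real n * a \<le> real n * b" using elim(1) b(2) by (simp add: field_simps)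
    then have "c * exp (real n * a) \<le> exp (real n * b)"
      using c by (metis exp_add exp_le_cancel_iff exp_ln)
    then show ?case using elim by (simp add: rate_le_iff)
  qed
  then have "limsup (rate M X A) \<le> ereal b" by (rule Limsup_bounded)
  then show False using b(1) by simp
qed

lemma rate_mono:
  assumes "A \<subseteq> B" "B \<in> sets (FC Cs)"
  shows "rate M X A n \<le> rate M X B n"
proof -
  have "prob {\<omega>\<in>space M. mean X n \<omega> \<in> A} \<le> prob {\<omega>\<in>space M. mean X n \<omega> \<in> B}"
    using assms by (intro finite_measure_mono mean_event) auto
  then have "elog (prob {\<omega>\<in>space M. mean X n \<omega> \<in> A}) \<le> elog (prob {\<omega>\<in>space M. mean X n \<omega> \<in> B})"
    by (auto simp: elog_def)
  then show ?thesis unfolding rate_def by (intro ereal_mult_left_mono) auto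
qed

section \<open>Supermultiplicative ball probabilities of the sums\<close>

definition sum_prob :: "('a \<Rightarrow> real) \<Rightarrow> nat \<Rightarrow> 'a \<Rightarrow> real \<Rightarrow> real" where
  "sum_prob q n z r = prob {\<omega>\<in>space M. q ((\<Sum>i<n. X i \<omega>) - z) < r}"

lemma ball_sets: "admissible Cs q \<Longrightarrow> {y. q (y - x) < r} \<in> sets (FC Cs)"
proof (cases "r > 0")
  case False
  assume "admissible Cs q"
  then have "seminorm q" by (simp add: admissible_def)
  then have "{y. q (y - x) < r} = {}" using False seminorm_nonneg[of q] by (auto simp: not_less intro: order.trans)
  then show ?thesis by simp
qed (auto simp: admissible_def intro!: Cx_sets_FC[of _ _ x])

lemma sum_event: "admissible Cs q \<Longrightarrow> {\<omega>\<in>space M. q ((\<Sum>i<n. X i \<omega>) - z) < r} \<in> events"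
  using measurable_sets[OF measurable_FC_sum[where f = X and I = "{..<n}", OF hX] ball_sets[where q = q and x = z and r = r]]
  by (simp add: vimage_def Int_def conj_commute)

text \<open>For unnormalised sums lengths, centres and radii simply add: independence multiplies the
  probabilities and the triangle inequality adds the balls.\<close>

lemma sum_prob_mult_le:
  assumes q: "admissible Cs q"
  shows "sum_prob q m z r * sum_prob q n w s \<le> sum_prob q (m + n) (z + w) (r + s)"
proof -
  have sq: "seminorm q" using q by (simp add: admissible_def)
  have "x + y \<in> {y. q (y - (z + w)) < r + s}" if "x \<in> {y. q (y - z) < r}" "y \<in> {y. q (y - w) < s}" for x y
    using that seminorm_add[OF sq, of "x - z" "y - w"] by (simp add: algebra_simps)
  from prob_sum_split[OF ball_sets[OF q] ball_sets[OF q] ball_sets[OF q] this, where m = m and n = n]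
  show ?thesis by (simp add: sum_prob_def)
qed

text \<open>The exponent is a successor: for exponent 0 the left side would be 1 while the open ball
  of radius 0 is empty.\<close>

lemma sum_prob_power_le:
  assumes q: "admissible Cs q"
  shows "sum_prob q m z r ^ Suc k \<le> sum_prob q (Suc k * m) (real (Suc k) *\<^sub>R z) (real (Suc k) * r)"
proof (induction k)
  case (Suc k)
  have "sum_prob q m z r ^ Suc (Suc k)
      \<le> sum_prob q m z r * sum_prob q (Suc k * m) (real (Suc k) *\<^sub>R z) (real (Suc k) * r)"
    using mult_left_mono[OF Suc.IH, of "sum_prob q m z r"] by (simp add: sum_prob_def)
  also have "\<dots> \<le> sum_prob q (m + Suc k * m) (z + real (Suc k) *\<^sub>R z) (r + real (Suc k) * r)"
    by (rule sum_prob_mult_le[OF q])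
  also have "\<dots> = sum_prob q (Suc (Suc k) * m) (real (Suc (Suc k)) *\<^sub>R z) (real (Suc (Suc k)) * r)"
  proof -
    have "z + real (Suc k) *\<^sub>R z = (1 + real (Suc k)) *\<^sub>R z" "r + real (Suc k) * r = (1 + real (Suc k)) * r"
      by (simp_all only: scaleR_add_left distrib_right scaleR_one mult_1)
    then show ?thesis by simp
  qed
  finally show ?case .
qed simp

lemma sum_prob_mono:
  assumes q: "admissible Cs q" and "r + q (z - w) \<le> s"
  shows "sum_prob q n z r \<le> sum_prob q n w s"
  unfolding sum_prob_def
proof (intro finite_measure_mono sum_event[OF q] subsetI)
  have sq: "seminorm q" using q by (simp add: admissible_def)
  fix \<omega> assume "\<omega> \<in> {\<omega>\<in>space M. q ((\<Sum>i<n. X i \<omega>) - z) < r}"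
  then show "\<omega> \<in> {\<omega>\<in>space M. q ((\<Sum>i<n. X i \<omega>) - w) < s}"
    using seminorm_triangle[OF sq, of "\<Sum>i<n. X i \<omega>" w z] assms(2) by simp
qed

lemma mean_ball_prob:
  assumes q: "admissible Cs q" and n: "n > 0"
  shows "prob {\<omega>\<in>space M. q (mean X n \<omega> - y) < r} = sum_prob q n (real n *\<^sub>R y) (real n * r)"
proof -
  have sq: "seminorm q" using q by (simp add: admissible_def)
  have "q (mean X n \<omega> - y) < r \<longleftrightarrow> q ((\<Sum>i<n. X i \<omega>) - real n *\<^sub>R y) < real n * r" for \<omega>
  proof -
    have "(\<Sum>i<n. X i \<omega>) - real n *\<^sub>R y = real n *\<^sub>R (mean X n \<omega> - y)"
      using n by (simp add: mean_def scaleR_diff_right)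
    then show ?thesis using n seminorm_scale[OF sq, of "real n"] by simp
  qed
  then show ?thesis by (simp add: sum_prob_def)
qed

text \<open>The balls of integer radius exhaust the space, so one of them carries at least half of
  the mass of \<open>X 0\<close>.\<close>

lemma sum_prob_tight:
  assumes q: "admissible Cs q"
  obtains B where "B > 0" "1 / 2 \<le> sum_prob q 1 0 B"
proof -
  let ?E = "\<lambda>k. {\<omega>\<in>space M. q ((\<Sum>i<1. X i \<omega>) - 0) < real k}"
  have inc: "incseq ?E" by (auto simp: incseq_def)
  have "(\<Union>k. ?E k) = space M" using reals_Archimedean2 by auto
  moreover have "(\<lambda>k. prob (?E k)) \<longlonglongrightarrow> prob (\<Union>k. ?E k)"
    by (intro finite_Lim_measure_incseq inc image_subsetI sum_event[OF q])
  ultimately have "(\<lambda>k. prob (?E k)) \<longlonglongrightarrow> 1" by (simp add: prob_space)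
  then have "\<forall>\<^sub>F k in sequentially. 1 / 2 < prob (?E k)" by (rule order_tendstoD) simp
  with eventually_gt_at_top[of 0] have "\<forall>\<^sub>F k in sequentially. k > 0 \<and> 1 / 2 < prob (?E k)"
    by eventually_elim simp
  then obtain k where "k > 0" "1 / 2 < prob (?E k)" by (auto dest: eventually_happens)
  then show ?thesis using that[of "real k"] by (simp add: sum_prob_def)
qed

text \<open>Repeat the block of length \<open>m\<close> and absorb the at most \<open>m\<close> remaining variables, which
  are bounded with positive probability, into the difference of the radii.\<close>

lemma mean_ball_growth:
  assumes q: "admissible Cs q" and m: "m > 0" and r: "r < s"
    and P: "exp (real m * a) \<le> prob {\<omega>\<in>space M. q (mean X m \<omega> - y) < r}"
  obtains c where "c > 0"
    "\<forall>\<^sub>F n in sequentially. c * exp (real n * a) \<le> prob {\<omega>\<in>space M. q (mean X n \<omega> - y) < s}"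
proof -
  have sq: "seminorm q" using q by (simp add: admissible_def)
  obtain B where B: "B > 0" "1 / 2 \<le> sum_prob q 1 0 B" using sum_prob_tight[OF q] by blast
  \<comment> \<open>A ball of nonpositive radius is empty, against the positive lower bound
    \<open>P\<close>.\<close>
  have r0: "r > 0"
  proof (rule ccontr)
    assume "\<not> r > 0"
    then have "{\<omega>\<in>space M. q (mean X m \<omega> - y) < r} = {}"
      using seminorm_nonneg[OF sq] by (auto simp: not_less intro: order.trans)
    then show False using P by (metis exp_gt_zero measure_empty not_le)
  qed
  \<comment> \<open>The power of 1/2 pays for at most \<open>m\<close> leftover variables, the
    exponential for replacing \<open>n\<close> by a multiple of \<open>m\<close> in the
    exponent.\<close>
  define c where "c = exp (- real m * \<bar>a\<bar>) * (1 / 2) ^ m"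
  \<comment> \<open>Such \<open>n\<close> leave room \<open>n * (s - r)\<close> for the shift of the
    centre and the spread of the leftover variables.\<close>
  have "\<forall>\<^sub>F n in sequentially. real m * (B + q y) / (s - r) \<le> real n"
    by (rule eventually_sequentiallyI[of "nat \<lceil>real m * (B + q y) / (s - r)\<rceil>"]) linarith
  then have "\<forall>\<^sub>F n in sequentially. c * exp (real n * a) \<le> prob {\<omega>\<in>space M. q (mean X n \<omega> - y) < s}"
    using eventually_gt_at_top[of m]
  proof eventually_elim
    case (elim n)
    \<comment> \<open>Dividing \<open>n - 1\<close> keeps the leftover length \<open>Suc j\<close>
      between 1 and \<open>m\<close>, and \<open>n > m\<close> gives at least one full block, so
      \<open>sum_prob_power_le\<close> applies to both parts.\<close>
    define k j where "k = (n - 1) div m - 1" and "j = (n - 1) mod m"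
    have "(n - 1) div m > 0" using elim(2) m by (simp add: div_greater_zero_iff)
    then have n: "n = Suc k * m + Suc j" and j: "Suc j \<le> m"
      using elim(2) m mod_less_divisor[OF m, of "n - 1"] div_mult_mod_eq[of "n - 1" m]
      by (auto simp: k_def j_def)
    have "exp (real m * a) ^ Suc k \<le> sum_prob q m (real m *\<^sub>R y) (real m * r) ^ Suc k"
      using P by (intro power_mono) (simp_all add: mean_ball_prob[OF q m])
    also have "\<dots> \<le> sum_prob q (Suc k * m) (real (Suc k) *\<^sub>R real m *\<^sub>R y) (real (Suc k) * (real m * r))"
      by (rule sum_prob_power_le[OF q])
    finally have 1: "exp (real m * a) ^ Suc k
        \<le> sum_prob q (Suc k * m) (real (Suc k) *\<^sub>R real m *\<^sub>R y) (real (Suc k) * (real m * r))" .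
    have "(1 / 2) ^ Suc j \<le> sum_prob q 1 0 B ^ Suc j" using B(2) by (intro power_mono) auto
    also have "\<dots> \<le> sum_prob q (Suc j * 1) (real (Suc j) *\<^sub>R 0) (real (Suc j) * B)"
      by (rule sum_prob_power_le[OF q])
    finally have 2: "(1 / 2) ^ Suc j \<le> sum_prob q (Suc j) 0 (real (Suc j) * B)" by simp
    have "exp (real m * a) ^ Suc k * (1 / 2) ^ Suc j
      \<le> sum_prob q (Suc k * m) (real (Suc k) *\<^sub>R real m *\<^sub>R y) (real (Suc k) * (real m * r)) * sum_prob q (Suc j) 0 (real (Suc j) * B)"
      using 1 2 by (intro mult_mono) (auto simp: sum_prob_def)
    also have "\<dots> \<le> sum_prob q n (real (Suc k) *\<^sub>R real m *\<^sub>R y + 0) (real (Suc k) * (real m * r) + real (Suc j) * B)"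
      unfolding n by (rule sum_prob_mult_le[OF q])
    also have "\<dots> \<le> sum_prob q n (real n *\<^sub>R y) (real n * s)"
    proof (rule sum_prob_mono[OF q])
      have nr: "real n = real (Suc k) * real m + real (Suc j)" using n by (metis of_nat_add of_nat_mult)
      have "real (Suc k) *\<^sub>R real m *\<^sub>R y + 0 - real n *\<^sub>R y = (- real (Suc j)) *\<^sub>R y"
        unfolding nr scaleR_add_left scaleR_minus_left by simp
      then have "q (real (Suc k) *\<^sub>R real m *\<^sub>R y + 0 - real n *\<^sub>R y) = real (Suc j) * q y"
        using seminorm_scale[OF sq, of "- real (Suc j)" y] by simp
      moreover have "real (Suc j) * (B + q y) \<le> real m * (B + q y)"
        using j B(1) seminorm_nonneg[OF sq, of y] by (intro mult_right_mono) auto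
      moreover have "real m * (B + q y) \<le> real n * (s - r)" using elim(1) r by (simp add: field_simps)
      moreover have "real (Suc k) * (real m * r) \<le> real n * r" unfolding nr using r0 by (simp add: algebra_simps)
      ultimately show "real (Suc k) * (real m * r) + real (Suc j) * B + q (real (Suc k) *\<^sub>R real m *\<^sub>R y + 0 - real n *\<^sub>R y) \<le> real n * s"
        by (simp add: algebra_simps)
    qed
    also have "\<dots> = prob {\<omega>\<in>space M. q (mean X n \<omega> - y) < s}"
      using elim(2) by (simp add: mean_ball_prob[OF q])
    finally have 3: "exp (real m * a) ^ Suc k * (1 / 2) ^ Suc j \<le> prob {\<omega>\<in>space M. q (mean X n \<omega> - y) < s}" .
    have nr: "real n = real (Suc k) * real m + real (Suc j)" using n by (metis of_nat_add of_nat_mult)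
    have "real (Suc j) * a \<le> real (Suc j) * \<bar>a\<bar>" by (intro mult_left_mono) auto
    also have "\<dots> \<le> real m * \<bar>a\<bar>" using j by (intro mult_right_mono) auto
    finally have "real (Suc j) * a \<le> real m * \<bar>a\<bar>" .
    then have "- real m * \<bar>a\<bar> + real n * a \<le> real (Suc k) * (real m * a)"
      unfolding nr by (simp add: algebra_simps)
    then have "exp (- real m * \<bar>a\<bar>) * exp (real n * a) \<le> exp (real m * a) ^ Suc k"
      unfolding exp_of_nat_mult[symmetric] exp_add[symmetric] exp_le_cancel_iff .
    moreover have "(1 / 2 :: real) ^ m \<le> (1 / 2) ^ Suc j" using j by (intro power_decreasing) auto
    ultimately have "exp (- real m * \<bar>a\<bar>) * exp (real n * a) * (1 / 2) ^ m \<le> exp (real m * a) ^ Suc k * (1 / 2) ^ Suc j"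
      by (intro mult_mono) auto
    then show ?case using 3 unfolding c_def by (simp add: mult.commute mult.left_commute)
  qed
  then show ?thesis using that[of c] by (simp add: c_def)
qed

text \<open>A single length \<open>m\<close> with rate above \<open>a\<close> forces a
  \<open>liminf\<close> of at least \<open>a\<close>, by \<open>mean_ball_growth\<close>. That lemma
  enlarges the radius, so the unit ball is first shrunk slightly; continuity of the measure from
  below keeps its probability above \<open>exp (m * a)\<close>.\<close>

lemma limsup_rate_le_liminf:
  assumes V: "V \<in> Cx Cs x"
  shows "limsup (rate M X V) \<le> liminf (rate M X V)"
proof (rule ccontr)
  assume "\<not> limsup (rate M X V) \<le> liminf (rate M X V)"
  then obtain a where a: "liminf (rate M X V) < ereal a" "ereal a < limsup (rate M X V)"
    using ereal_dense2[of "liminf (rate M X V)" "limsup (rate M X V)"] by (auto simp: not_le)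
  obtain q where q: "admissible Cs q" and Vq: "V = {y. q (y - x) < 1}"
    using Cx_seminorm_ball[OF hC V] by blast
  have sq: "seminorm q" using q by (simp add: admissible_def)
  have "\<exists>m>0. ereal a < rate M X V m"
  proof (rule ccontr)
    assume "\<not> (\<exists>m>0. ereal a < rate M X V m)"
    then have "\<forall>\<^sub>F m in sequentially. rate M X V m \<le> ereal a"
      by (intro eventually_sequentiallyI[of 1]) (metis not_le One_nat_def Suc_le_eq)
    then have "limsup (rate M X V) \<le> ereal a" by (rule Limsup_bounded)
    then show False using a(2) by simp
  qed
  then obtain m where m: "m > 0" "ereal a < rate M X V m" by blast
  then have P: "exp (real m * a) < prob {\<omega>\<in>space M. q (mean X m \<omega> - x) < 1}"
  proof -
    have "\<not> rate M X V m \<le> ereal a" using m(2) by simp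
    then show ?thesis unfolding rate_le_iff[OF m(1)] Vq by simp
  qed
  let ?E = "\<lambda>k. {\<omega>\<in>space M. q (mean X m \<omega> - x) < 1 - 1 / real (Suc k)}"
  have ev: "?E k \<in> events" for k using mean_event[OF ball_sets[OF q, of x]] by simp
  have inc: "incseq ?E"
  proof (rule incseq_SucI, rule subsetI)
    fix k \<omega> assume "\<omega> \<in> ?E k"
    moreover have "1 - 1 / real (Suc k) \<le> 1 - 1 / real (Suc (Suc k))" by (simp add: frac_le)
    ultimately show "\<omega> \<in> ?E (Suc k)" by simp
  qed
  have un: "(\<Union>k. ?E k) = {\<omega>\<in>space M. q (mean X m \<omega> - x) < 1}"
  proof (intro equalityI subsetI)
    fix \<omega> assume w: "\<omega> \<in> {\<omega>\<in>space M. q (mean X m \<omega> - x) < 1}"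
    then obtain k where "1 / real (Suc k) < 1 - q (mean X m \<omega> - x)"
      using nat_approx_posE[of "1 - q (mean X m \<omega> - x)"] by auto
    then show "\<omega> \<in> (\<Union>k. ?E k)" using w by (intro UN_I[of k]) auto
  next
    fix \<omega> assume "\<omega> \<in> (\<Union>k. ?E k)"
    then obtain k where "\<omega> \<in> ?E k" by blast
    moreover have "1 - 1 / real (Suc k) < 1" by simp
    ultimately show "\<omega> \<in> {\<omega>\<in>space M. q (mean X m \<omega> - x) < 1}" by (auto intro: less_trans)
  qed
  have "(\<lambda>k. prob (?E k)) \<longlonglongrightarrow> prob (\<Union>k. ?E k)"
    using inc ev by (intro finite_Lim_measure_incseq) auto
  then have "\<forall>\<^sub>F k in sequentially. exp (real m * a) < prob (?E k)"
    using P unfolding un by (rule order_tendstoD(1))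
  then obtain k where k: "exp (real m * a) < prob (?E k)" by (auto dest: eventually_happens)
  have "1 - 1 / real (Suc k) < 1" by simp
  from mean_ball_growth[OF q m(1) this less_imp_le[OF k]] obtain c where c: "c > 0"
    "\<forall>\<^sub>F n in sequentially. c * exp (real n * a) \<le> prob {\<omega>\<in>space M. q (mean X n \<omega> - x) < 1}" by blast
  have "ereal a \<le> liminf (rate M X V)" by (rule liminf_rate_ge[OF c(1)]) (use c(2) Vq in simp)
  then show False using a(1) by simp
qed

section \<open>The weak large deviation principle\<close>

lemma weak_LDP_lower:
  assumes G: "G \<in> sets (FC Cs)"
  shows "(SUP x\<in>(tauC Cs) interior_of G. Defs.entropy Cs M X x) \<le> liminf (rate M X G)"
proof (rule SUP_least)
  fix x assume "x \<in> (tauC Cs) interior_of G"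
  then obtain V where V: "V \<in> Cx Cs x" "V \<subseteq> (tauC Cs) interior_of G"
    using openin_interior_of[of "tauC Cs" G] unfolding openin_tauC by blast
  have "Defs.entropy Cs M X x \<le> liminf (rate M X V)" unfolding Defs.entropy_def using V(1) by (rule INF_lower)
  also have "\<dots> \<le> liminf (rate M X G)"
    using V(2) interior_of_subset[of "tauC Cs" G]
    by (intro Liminf_mono always_eventually allI rate_mono[OF _ G]) blast
  finally show "Defs.entropy Cs M X x \<le> liminf (rate M X G)" .
qed

lemma openin_Cx: "V \<in> Cx Cs x \<Longrightarrow> openin (tauC Cs) V"
proof -
  assume "V \<in> Cx Cs x"
  then obtain q where q: "admissible Cs q" "V = {y. q (y - x) < 1}" using Cx_seminorm_ball[OF hC] by blast
  have sq: "seminorm q" using q by (simp add: admissible_def)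
  show ?thesis
    unfolding openin_tauC
  proof
    fix y assume y: "y \<in> V"
    have "{z. q (z - y) < 1 - q (y - x)} \<subseteq> V"
    proof
      fix z assume "z \<in> {z. q (z - y) < 1 - q (y - x)}"
      then show "z \<in> V" using seminorm_triangle[OF sq, of z x y] q(2) by simp
    qed
    moreover have "{z. q (z - y) < 1 - q (y - x)} \<in> Cx Cs y" using q y by (simp add: admissible_def)
    ultimately show "\<exists>W\<in>Cx Cs y. W \<subseteq> V" by blast
  qed
qed

lemma Cx_self: "V \<in> Cx Cs x \<Longrightarrow> x \<in> V"
proof -
  assume "V \<in> Cx Cs x"
  then obtain q where q: "admissible Cs q" "V = {y. q (y - x) < 1}" using Cx_seminorm_ball[OF hC] by blast
  then show ?thesis using seminorm_zero[of q] by (simp add: admissible_def)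
qed

lemma weak_LDP_upper:
  assumes K: "K \<in> sets (FC Cs)" and comp: "compactin (tauC Cs) ((tauC Cs) closure_of K)"
  shows "limsup (rate M X K) \<le> (SUP x\<in>(tauC Cs) closure_of K. Defs.entropy Cs M X x)"
proof (rule ccontr)
  let ?S = "SUP x\<in>(tauC Cs) closure_of K. Defs.entropy Cs M X x"
  assume "\<not> limsup (rate M X K) \<le> ?S"
  then obtain a where a: "?S < ereal a" "ereal a < limsup (rate M X K)"
    using ereal_dense2[of ?S "limsup (rate M X K)"] by (auto simp: not_le)
  \<comment> \<open>The entropy controls only a \<open>liminf\<close>;
    \<open>limsup_rate_le_liminf\<close> is what makes these sets cover the closure.\<close>
  define \<U> where "\<U> = {V. (\<exists>x. V \<in> Cx Cs x) \<and> limsup (rate M X V) < ereal a}"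
  have "(tauC Cs) closure_of K \<subseteq> \<Union>\<U>"
  proof
    fix x assume "x \<in> (tauC Cs) closure_of K"
    then have "Defs.entropy Cs M X x < ereal a" using a(1) by (meson SUP_upper le_less_trans)
    then obtain V where V: "V \<in> Cx Cs x" "liminf (rate M X V) < ereal a"
      unfolding Defs.entropy_def INF_less_iff by blast
    then have "V \<in> \<U>" using limsup_rate_le_liminf[OF V(1)] unfolding \<U>_def by (auto intro: le_less_trans)
    then show "x \<in> \<Union>\<U>" using Cx_self[OF V(1)] by blast
  qed
  moreover have "openin (tauC Cs) V" if "V \<in> \<U>" for V using that openin_Cx by (auto simp: \<U>_def)
  ultimately obtain \<F> where F: "finite \<F>" "\<F> \<subseteq> \<U>" "(tauC Cs) closure_of K \<subseteq> \<Union>\<F>"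
    using compactinD[OF comp, of \<U>] by blast
  have KF: "K \<subseteq> \<Union>\<F>" using F(3) closure_of_subset[of K "tauC Cs"] by auto
  have meas: "V \<in> sets (FC Cs)" if "V \<in> \<F>" for V using that F(2) Cx_sets_FC by (auto simp: \<U>_def)
  have "\<forall>\<^sub>F n in sequentially. \<forall>V\<in>\<F>. rate M X V n < ereal a"
    unfolding eventually_ball_finite_distrib[OF F(1)]
  proof
    fix V assume "V \<in> \<F>"
    then have "limsup (rate M X V) < ereal a" using F(2) by (auto simp: \<U>_def)
    then show "\<forall>\<^sub>F n in sequentially. rate M X V n < ereal a" by (rule Limsup_lessD)
  qed
  \<comment> \<open>The added 1 keeps the constant positive when the finite subcover is
    empty.\<close>
  then have "\<forall>\<^sub>F n in sequentially. prob {\<omega>\<in>space M. mean X n \<omega> \<in> K} \<le> (real (card \<F>) + 1) * exp (real n * a)"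
    using eventually_gt_at_top[of 0]
  proof eventually_elim
    case (elim n)
    have "prob {\<omega>\<in>space M. mean X n \<omega> \<in> K} \<le> prob (\<Union>V\<in>\<F>. {\<omega>\<in>space M. mean X n \<omega> \<in> V})"
      using KF F(1) meas by (intro finite_measure_mono sets.finite_UN mean_event) auto
    also have "\<dots> \<le> (\<Sum>V\<in>\<F>. prob {\<omega>\<in>space M. mean X n \<omega> \<in> V})"
      using F(1) meas mean_event by (intro finite_measure_subadditive_finite) auto
    also have "\<dots> \<le> (\<Sum>V\<in>\<F>. exp (real n * a))"
      using elim by (intro sum_mono) (auto simp: rate_less_iff less_imp_le)
    also have "\<dots> \<le> (real (card \<F>) + 1) * exp (real n * a)" by (simp add: distrib_right)
    finally show ?case .
  qed
  then have "limsup (rate M X K) \<le> ereal a" by (intro limsup_rate_le[of "real (card \<F>) + 1"]) auto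
  then show False using a(2) by simp
qed

section \<open>Entropy and pressure\<close>

lemma eln_le: "Z \<le> ennreal (exp b) \<Longrightarrow> eln Z \<le> ereal b"
proof (cases Z)
  case (real z)
  assume "Z \<le> ennreal (exp b)"
  with real have "z \<le> exp b" by (simp add: ennreal_le_iff)
  then have "z > 0 \<Longrightarrow> ln z \<le> b" by (metis exp_gt_zero ln_exp ln_le_cancel_iff)
  with real show ?thesis by (auto simp: eln_def)
qed (auto simp: eln_def top_unique)

lemma pressure_nonzero: "l \<in> dualC Cs \<Longrightarrow> (\<integral>\<^sup>+\<omega>. ennreal (exp (l (X 0 \<omega>))) \<partial>M) \<noteq> 0"
proof
  assume l: "l \<in> dualC Cs" and 0: "(\<integral>\<^sup>+\<omega>. ennreal (exp (l (X 0 \<omega>))) \<partial>M) = 0"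
  have "(\<lambda>\<omega>. l (X 0 \<omega>)) \<in> borel_measurable M"
    using measurable_compose[OF hX measurable_dualC[OF l]] .
  then have "AE \<omega> in M. ennreal (exp (l (X 0 \<omega>))) = 0" using 0 by (subst (asm) nn_integral_0_iff_AE) auto
  then have "AE \<omega> in M. False" by eventually_elim (simp add: ennreal_eq_0_iff not_le)
  then show False by simp
qed

lemma linear_mean: "linear l \<Longrightarrow> n > 0 \<Longrightarrow> (\<Sum>i<n. l (X i \<omega>)) = real n * l (mean X n \<omega>)"
  by (simp add: mean_def linear_cmul linear_sum)

text \<open>Exponential Markov inequality: on a ball around \<open>x\<close> where \<open>l\<close>
  is at least \<open>l x - e\<close>, the indicator is bounded by
  \<open>exp (n * (l y - l x + e))\<close> at the mean \<open>y\<close>, and the expectation of this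
  factorises by independence.\<close>

lemma entropy_le_pressure:
  assumes l: "l \<in> dualC Cs" and z: "z > 0" and Z: "(\<integral>\<^sup>+\<omega>. ennreal (exp (l (X 0 \<omega>))) \<partial>M) = ennreal z"
  shows "Defs.entropy Cs M X x \<le> ereal (ln z - l x)"
proof (rule ereal_le_epsilon2)
  fix e :: real assume e: "e > 0"
  have lin: "linear l" using l by (auto simp: dualC_def)
  obtain q where q: "admissible Cs q" "\<And>x. \<bar>l x\<bar> \<le> q x" using dualC_dominated[OF l] by blast
  define V where "V = {y. q (y - x) < e}"
  have V: "V \<in> Cx Cs x" using q(1) e by (simp add: admissible_def V_def)
  have lV: "l x - e \<le> l y" if "y \<in> V" for y
    using that q(2)[of "y - x"] linear_diff[OF lin, of y x] by (simp add: V_def)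
  have "\<forall>\<^sub>F n in sequentially. prob {\<omega>\<in>space M. mean X n \<omega> \<in> V} \<le> 1 * exp (real n * (ln z - l x + e))"
    using eventually_gt_at_top[of 0]
  proof eventually_elim
    case (elim n)
    let ?E = "{\<omega>\<in>space M. mean X n \<omega> \<in> V}"
    let ?b = "exp (- (real n * (l x - e)))"
    have "emeasure M ?E = (\<integral>\<^sup>+\<omega>. indicator ?E \<omega> \<partial>M)"
      using mean_event[OF Cx_sets_FC[OF V]] by simp
    also have "\<dots> \<le> (\<integral>\<^sup>+\<omega>. ennreal ?b * (\<Prod>i<n. ennreal (exp (l (X i \<omega>)))) \<partial>M)"
    proof (rule nn_integral_mono)
      fix \<omega>
      have "(\<Prod>i<n. ennreal (exp (l (X i \<omega>)))) = ennreal (exp (real n * l (mean X n \<omega>)))"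
        using elim by (simp add: prod_ennreal exp_sum[symmetric] linear_mean[OF lin])
      then have eq: "ennreal ?b * (\<Prod>i<n. ennreal (exp (l (X i \<omega>)))) = ennreal (exp (real n * (l (mean X n \<omega>) - (l x - e))))"
        by (simp add: ennreal_mult[symmetric] exp_add[symmetric] algebra_simps)
      show "indicator ?E \<omega> \<le> ennreal ?b * (\<Prod>i<n. ennreal (exp (l (X i \<omega>))))"
      proof (cases "\<omega> \<in> ?E")
        case True
        then have "0 \<le> real n * (l (mean X n \<omega>) - (l x - e))" using lV[of "mean X n \<omega>"] by simp
        then show ?thesis using True unfolding eq by simp
      qed simp
    qed
    also have "\<dots> = ennreal ?b * (\<integral>\<^sup>+\<omega>. (\<Prod>i<n. ennreal (exp (l (X i \<omega>)))) \<partial>M)"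
    proof (rule nn_integral_cmult)
      have [measurable]: "(\<lambda>\<omega>. l (X i \<omega>)) \<in> borel_measurable M" for i
        using measurable_compose[OF hX measurable_dualC[OF l]] .
      show "(\<lambda>\<omega>. \<Prod>i<n. ennreal (exp (l (X i \<omega>)))) \<in> borel_measurable M" by measurable
    qed
    also have "\<dots> = ennreal ?b * ennreal z ^ n"
    proof -
      have "(\<lambda>y. ennreal (exp (l y))) \<in> borel_measurable (FC Cs)"
        using measurable_dualC[OF l] by measurable
      from nn_integral_prod_iid[OF this, of n] show ?thesis unfolding Z by simp
    qed
    also have "\<dots> = ennreal (exp (real n * (ln z - l x + e)))"
    proof -
      have "z ^ n = exp (real n * ln z)" using z by (simp add: exp_of_nat_mult)
      then have "?b * z ^ n = exp (real n * (ln z - l x + e))"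
        by (simp add: exp_add[symmetric] algebra_simps)
      then show ?thesis using z by (simp add: ennreal_power ennreal_mult[symmetric])
    qed
    finally show ?case by (simp add: emeasure_eq_measure)
  qed
  then have "limsup (rate M X V) \<le> ereal (ln z - l x + e)" by (rule limsup_rate_le[rotated]) simp
  moreover have "Defs.entropy Cs M X x \<le> liminf (rate M X V)"
    unfolding Defs.entropy_def using V by (rule INF_lower)
  moreover have "liminf (rate M X V) \<le> limsup (rate M X V)" by (rule Liminf_le_Limsup) simp
  ultimately show "Defs.entropy Cs M X x \<le> ereal (ln z - l x) + ereal e"
    by (auto intro: order.trans)
qed

lemma entropy_le_pstar: "Defs.entropy Cs M X x \<le> - pstar Cs M X x"
proof -
  have "pstar Cs M X x \<le> - Defs.entropy Cs M X x"
    unfolding pstar_def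
  proof (rule SUP_least)
    fix l assume l: "l \<in> dualC Cs"
    define Z where "Z = (\<integral>\<^sup>+\<omega>. ennreal (exp (l (X 0 \<omega>))) \<partial>M)"
    have Z0: "Z \<noteq> 0" using pressure_nonzero[OF l] by (simp add: Z_def)
    have pZ: "pressure M X l = eln Z" by (simp add: pressure_def Z_def)
    show "ereal (l x) - pressure M X l \<le> - Defs.entropy Cs M X x"
    proof (cases Z)
      case (real z)
      then have z: "z > 0" using Z0 by (auto simp: less_le)
      have "Defs.entropy Cs M X x \<le> ereal (ln z - l x)"
        by (rule entropy_le_pressure[OF l z]) (use real in \<open>simp add: Z_def\<close>)
      then have "- ereal (ln z - l x) \<le> - Defs.entropy Cs M X x"
        unfolding ereal_minus_le_minus .
      moreover have "ereal (l x) - pressure M X l = - ereal (ln z - l x)"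
        unfolding pZ using real z by (simp add: eln_def)
      ultimately show ?thesis by simp
    next
      \<comment> \<open>An infinite Laplace transform contributes \<open>- \<infinity>\<close> to
        the supremum.\<close>
      case top
      then show ?thesis unfolding pZ by (simp add: eln_def)
    qed
  qed
  then show ?thesis using ereal_uminus_le_reorder ereal_minus_le_minus by (metis ereal_uminus_uminus)
qed

text \<open>The hypograph of the concave function \<open>y \<mapsto> lim 1/n log P(q(mean - y) < r)\<close>; quantifying over
  smaller radii and over a constant \<open>c\<close> makes it exactly convex.\<close>

definition ball_hypograph :: "('a \<Rightarrow> real) \<Rightarrow> real \<Rightarrow> ('a \<times> real) set" where
  "ball_hypograph q r = {(y, t). \<exists>s<r. \<exists>c>0. \<forall>\<^sub>F n in sequentially.
      c * exp (real n * t) \<le> prob {\<omega>\<in>space M. q (mean X n \<omega> - y) < s}}"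

text \<open>Of \<open>n\<close> variables about \<open>u * n\<close> are steered to \<open>y\<close>
  and the others to \<open>z\<close>. Rounding changes the block lengths by at most 1, which shifts
  the centre of the sum by at most \<open>q (y - z)\<close> and the exponent by at most
  \<open>\<bar>t - w\<bar>\<close>; the radius gained between \<open>s0\<close> and \<open>s\<close>
  and the constant \<open>c\<close> absorb this.\<close>

lemma convex_ball_hypograph:
  assumes q: "admissible Cs q"
  shows "convex (ball_hypograph q r)"
proof (rule convexI)
  fix a b and u v :: real
  assume a: "a \<in> ball_hypograph q r" and b: "b \<in> ball_hypograph q r" and uv: "0 \<le> u" "0 \<le> v" "u + v = 1"
  have sq: "seminorm q" using q by (simp add: admissible_def)
  obtain y t z w where ab: "a = (y, t)" "b = (z, w)" by (cases a, cases b)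
  obtain s1 c1 where 1: "s1 < r" "c1 > 0"
      "\<forall>\<^sub>F n in sequentially. c1 * exp (real n * t) \<le> prob {\<omega>\<in>space M. q (mean X n \<omega> - y) < s1}"
    using a unfolding ab ball_hypograph_def by blast
  obtain s2 c2 where 2: "s2 < r" "c2 > 0"
      "\<forall>\<^sub>F n in sequentially. c2 * exp (real n * w) \<le> prob {\<omega>\<in>space M. q (mean X n \<omega> - z) < s2}"
    using b unfolding ab ball_hypograph_def by blast
  show "u *\<^sub>R a + v *\<^sub>R b \<in> ball_hypograph q r"
  \<comment> \<open>With a zero weight one block length would stay bounded and its eventual estimate
    would be out of reach, so this case is settled apart.\<close>
  proof (cases "u = 0 \<or> v = 0")
    case True
    then show ?thesis using a b uv by auto
  next
    case False
    then have u: "u > 0" and v: "v > 0" using uv by auto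
    define s0 where "s0 = max s1 s2"
    define s where "s = (s0 + r) / 2"
    have s: "s0 < s" "s < r" using 1(1) 2(1) by (auto simp: s_def s0_def)
    define c where "c = c1 * c2 * exp (- \<bar>t - w\<bar>)"
    define m where "m n = nat \<lfloor>u * real n\<rfloor>" for n
    define k where "k n = n - m n" for n
    have m_le: "real (m n) \<le> u * real n" "u * real n - 1 < real (m n)" for n
    proof -
      have "0 \<le> u * real n" using u by simp
      then have "real (m n) = of_int \<lfloor>u * real n\<rfloor>" unfolding m_def by simp
      then show "real (m n) \<le> u * real n" "u * real n - 1 < real (m n)" by linarith+
    qed
    have un: "u * real n \<le> real n" for n using uv mult_right_mono[of u 1 "real n"] by simp
    have mk: "m n + k n = n" for n
    proof -
      have "real (m n) \<le> real n" using m_le(1)[of n] un[of n] by linarith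
      then show ?thesis by (simp add: k_def)
    qed
    have kr: "real (k n) = real n - real (m n)" for n using mk[of n] by linarith
    have vn: "v * real n = real n - u * real n" for n using uv(3) by (simp add: algebra_simps flip: distrib_right)
    have to_inf: "filterlim f at_top sequentially" if "\<epsilon> > 0" "\<And>n. \<epsilon> * real n - 1 \<le> real (f n)" for f \<epsilon>
      unfolding filterlim_at_top
    proof (intro allI eventually_sequentiallyI)
      fix Z n assume "nat \<lceil>(real Z + 1) / \<epsilon>\<rceil> \<le> n"
      then have "(real Z + 1) / \<epsilon> \<le> real n" by linarith
      then have "real Z + 1 \<le> \<epsilon> * real n" using that(1) by (simp add: field_simps)
      then show "Z \<le> f n" using that(2)[of n] by linarith
    qed
    have fm: "filterlim m at_top sequentially"
      using m_le(2) by (intro to_inf[OF u]) (simp add: less_imp_le)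
    have fk: "filterlim k at_top sequentially"
    proof (rule to_inf[OF v])
      fix n show "v * real n - 1 \<le> real (k n)" using m_le(1)[of n] vn[of n] kr[of n] by linarith
    qed
    have "\<forall>\<^sub>F n in sequentially. q (y - z) / (s - s0) \<le> real n"
      by (rule eventually_sequentiallyI[of "nat \<lceil>q (y - z) / (s - s0)\<rceil>"]) linarith
    then have "\<forall>\<^sub>F n in sequentially. c * exp (real n * (u * t + v * w))
        \<le> prob {\<omega>\<in>space M. q (mean X n \<omega> - (u *\<^sub>R y + v *\<^sub>R z)) < s}"
      using eventually_compose_filterlim[OF 1(3) fm] eventually_compose_filterlim[OF 2(3) fk]
        eventually_compose_filterlim[OF eventually_gt_at_top[of 0] fm]
        eventually_compose_filterlim[OF eventually_gt_at_top[of 0] fk]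
    proof eventually_elim
      case (elim n)
      define d where "d = real (m n) - u * real n"
      have d: "\<bar>d\<bar> \<le> 1" using m_le[of n] by (simp add: d_def)
      have m: "real (m n) = u * real n + d" and k: "real (k n) = v * real n - d"
        using kr[of n] vn[of n] by (simp_all add: d_def)
      have n0: "n > 0" using mk[of n] elim(4) by linarith
      have "(c1 * exp (real (m n) * t)) * (c2 * exp (real (k n) * w))
          \<le> sum_prob q (m n) (real (m n) *\<^sub>R y) (real (m n) * s1) * sum_prob q (k n) (real (k n) *\<^sub>R z) (real (k n) * s2)"
        using elim 1(2) 2(2) by (intro mult_mono) (auto simp: mean_ball_prob[OF q] sum_prob_def)
      also have "\<dots> \<le> sum_prob q (m n + k n) (real (m n) *\<^sub>R y + real (k n) *\<^sub>R z) (real (m n) * s1 + real (k n) * s2)"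
        by (rule sum_prob_mult_le[OF q])
      also have "\<dots> \<le> sum_prob q n (real n *\<^sub>R (u *\<^sub>R y + v *\<^sub>R z)) (real n * s)"
        unfolding mk
      proof (rule sum_prob_mono[OF q])
        have "real (m n) *\<^sub>R y + real (k n) *\<^sub>R z - real n *\<^sub>R (u *\<^sub>R y + v *\<^sub>R z) = d *\<^sub>R (y - z)"
          unfolding m k by (simp add: algebra_simps)
        then have "q (real (m n) *\<^sub>R y + real (k n) *\<^sub>R z - real n *\<^sub>R (u *\<^sub>R y + v *\<^sub>R z)) = \<bar>d\<bar> * q (y - z)"
          by (simp add: seminorm_scale[OF sq])
        also have "\<dots> \<le> q (y - z)" using d seminorm_nonneg[OF sq, of "y - z"] mult_right_mono[of "\<bar>d\<bar>" 1 "q (y - z)"] by simp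
        also have "\<dots> \<le> real n * (s - s0)" using elim(1) s by (simp add: field_simps)
        finally have 3: "q (real (m n) *\<^sub>R y + real (k n) *\<^sub>R z - real n *\<^sub>R (u *\<^sub>R y + v *\<^sub>R z)) \<le> real n * (s - s0)" .
        have "real (m n) * s1 \<le> real (m n) * s0" "real (k n) * s2 \<le> real (k n) * s0"
          by (auto simp: s0_def intro!: mult_left_mono)
        moreover have "real (m n) + real (k n) = real n" using kr[of n] by simp
        ultimately have "real (m n) * s1 + real (k n) * s2 \<le> real n * s0"
          by (metis add_mono distrib_right)
        then show "real (m n) * s1 + real (k n) * s2
            + q (real (m n) *\<^sub>R y + real (k n) *\<^sub>R z - real n *\<^sub>R (u *\<^sub>R y + v *\<^sub>R z)) \<le> real n * s"
          using 3 unfolding right_diff_distrib by linarith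
      qed
      also have "\<dots> = prob {\<omega>\<in>space M. q (mean X n \<omega> - (u *\<^sub>R y + v *\<^sub>R z)) < s}"
        using n0 by (simp add: mean_ball_prob[OF q])
      finally have 4: "(c1 * exp (real (m n) * t)) * (c2 * exp (real (k n) * w))
          \<le> prob {\<omega>\<in>space M. q (mean X n \<omega> - (u *\<^sub>R y + v *\<^sub>R z)) < s}" .
      have "d * (t - w) \<ge> - \<bar>t - w\<bar>"
      proof -
        have "\<bar>d * (t - w)\<bar> \<le> 1 * \<bar>t - w\<bar>" unfolding abs_mult using d by (intro mult_right_mono) auto
        then show ?thesis by (metis abs_le_D2 minus_le_iff mult_1)
      qed
      then have "- \<bar>t - w\<bar> + real n * (u * t + v * w) \<le> real (m n) * t + real (k n) * w"
        unfolding m k by (simp add: algebra_simps)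
      then have "exp (- \<bar>t - w\<bar>) * exp (real n * (u * t + v * w)) \<le> exp (real (m n) * t) * exp (real (k n) * w)"
        unfolding exp_add[symmetric] exp_le_cancel_iff .
      then have "(c1 * c2) * (exp (- \<bar>t - w\<bar>) * exp (real n * (u * t + v * w))) \<le> (c1 * c2) * (exp (real (m n) * t) * exp (real (k n) * w))"
        using 1(2) 2(2) by (intro mult_left_mono) auto
      then show ?case using 4 unfolding c_def by (simp add: mult_ac)
    qed
    moreover have "c > 0" using 1(2) 2(2) by (simp add: c_def)
    ultimately show ?thesis using s(2) unfolding ab ball_hypograph_def by auto
  qed
qed

lemma ball_hypograph_nonpos:
  assumes "(y, t) \<in> ball_hypograph q r"
  shows "t \<le> 0"
proof -
  obtain s c where sc: "c > 0"
      "\<forall>\<^sub>F n in sequentially. c * exp (real n * t) \<le> prob {\<omega>\<in>space M. q (mean X n \<omega> - y) < s}"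
    using assms unfolding ball_hypograph_def by blast
  have "\<forall>\<^sub>F n in sequentially. c * exp (real n * t) \<le> prob {\<omega>\<in>space M. mean X n \<omega> \<in> UNIV}"
    using sc(2) by eventually_elim (simp add: prob_space order.trans[OF _ prob_le_1])
  then have "ereal t \<le> liminf (rate M X UNIV)" by (rule liminf_rate_ge[OF sc(1)])
  also have "rate M X UNIV = (\<lambda>_. 0)"
    by (simp add: rate_def prob_space elog_def fun_eq_iff)
  also have "liminf (\<lambda>_. 0 :: ereal) = 0" by (simp add: Liminf_const)
  finally show ?thesis by simp
qed

text \<open>The assumption \<open>le\<close> places the ball of radius \<open>r\<close> around
  \<open>y\<close> inside the unit ball around \<open>x\<close>.\<close>

lemma ball_hypograph_le_liminf:
  assumes q: "admissible Cs q" and "(y, t) \<in> ball_hypograph q r" and le: "q (y - x) + r \<le> 1"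
  shows "ereal t \<le> liminf (rate M X {z. q (z - x) < 1})"
proof -
  have sq: "seminorm q" using q by (simp add: admissible_def)
  obtain s c where sc: "s < r" "c > 0"
      "\<forall>\<^sub>F n in sequentially. c * exp (real n * t) \<le> prob {\<omega>\<in>space M. q (mean X n \<omega> - y) < s}"
    using assms(2) unfolding ball_hypograph_def by blast
  show ?thesis
  proof (rule liminf_rate_ge[OF sc(2)])
    show "\<forall>\<^sub>F n in sequentially. c * exp (real n * t) \<le> prob {\<omega>\<in>space M. mean X n \<omega> \<in> {z. q (z - x) < 1}}"
      using sc(3)
    proof eventually_elim
      case (elim n)
      have "prob {\<omega>\<in>space M. q (mean X n \<omega> - y) < s} \<le> prob {\<omega>\<in>space M. mean X n \<omega> \<in> {z. q (z - x) < 1}}"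
      proof (intro finite_measure_mono mean_event ball_sets[OF q] subsetI)
        fix \<omega> assume "\<omega> \<in> {\<omega>\<in>space M. q (mean X n \<omega> - y) < s}"
        then show "\<omega> \<in> {\<omega>\<in>space M. mean X n \<omega> \<in> {z. q (z - x) < 1}}"
          using seminorm_triangle[OF sq, of "mean X n \<omega>" x y] sc(1) le by simp
      qed
      then show ?case using elim by linarith
    qed
  qed
qed

text \<open>An average of the points \<open>d 0, ..., d (k - 1)\<close> is determined by the
  frequencies with which they occur. Rounding these down to multiples of \<open>1 / N\<close> leaves
  finitely many combinations and moves the average by at most \<open>S / N\<close>, whatever
  \<open>n\<close> is.\<close>

lemma mean_net:
  fixes d :: "nat \<Rightarrow> 'a"
  assumes sq: "seminorm q" and e: "e > 0"
  obtains Y where "finite Y"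
    "\<And>n J. n > 0 \<Longrightarrow> (\<And>i. i < n \<Longrightarrow> J i < k) \<Longrightarrow> \<exists>y\<in>Y. q ((1 / real n) *\<^sub>R (\<Sum>i<n. d (J i)) - y) < e"
proof -
  define S where "S = (\<Sum>j<k. q (d j))"
  have S0: "S \<ge> 0" unfolding S_def by (intro sum_nonneg seminorm_nonneg[OF sq])
  obtain N where N: "N > 0" "S / real N < e"
  proof -
    obtain N where N: "S / e < real N" using reals_Archimedean2 by blast
    then have "real N > 0" using S0 e by (meson divide_nonneg_pos le_less_trans)
    with N e show ?thesis by (intro that[of N]) (auto simp: field_simps)
  qed
  define Y where "Y = (\<lambda>h. \<Sum>j<k. (real (h j) / real N) *\<^sub>R d j) ` ({..<k} \<rightarrow>\<^sub>E {..N})"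
  have "finite Y" unfolding Y_def by (intro finite_imageI finite_PiE) auto
  moreover have "\<exists>y\<in>Y. q ((1 / real n) *\<^sub>R (\<Sum>i<n. d (J i)) - y) < e"
    if n: "n > 0" and J: "\<And>i. i < n \<Longrightarrow> J i < k" for n J
  proof -
    define a where "a j = real (card {i. i < n \<and> J i = j}) / real n" for j
    define h where "h = (\<lambda>j\<in>{..<k}. nat \<lfloor>real N * a j\<rfloor>)"
    have a: "0 \<le> a j" "a j \<le> 1" for j
    proof -
      have "card {i. i < n \<and> J i = j} \<le> card {..<n}" by (intro card_mono) auto
      then show "0 \<le> a j" "a j \<le> 1" using n by (auto simp: a_def)
    qed
    have ah: "\<bar>a j - real (h j) / real N\<bar> \<le> 1 / real N" "h j \<le> N" if "j < k" for j
    proof -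
      have Na: "0 \<le> real N * a j" "real N * a j \<le> real N"
        using a[of j] N(1) by (auto simp: mult_left_le)
      then have hj: "real (h j) = of_int \<lfloor>real N * a j\<rfloor>" using that by (simp add: h_def)
      then have "\<bar>real N * a j - real (h j)\<bar> \<le> 1" by linarith
      then have "\<bar>real N * a j - real (h j)\<bar> / real N \<le> 1 / real N" by (rule divide_right_mono) simp
      moreover have "a j - real (h j) / real N = (real N * a j - real (h j)) / real N"
        using N(1) by (simp add: field_simps)
      ultimately show "\<bar>a j - real (h j) / real N\<bar> \<le> 1 / real N" by simp
      have "real (h j) \<le> real N" using hj Na(2) by linarith
      then show "h j \<le> N" by simp
    qed
    have "(\<Sum>i<n. d (J i)) = (\<Sum>j<k. \<Sum>i\<in>{i\<in>{..<n}. J i = j}. d (J i))"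
      using J by (intro sum.group[symmetric]) auto
    also have "\<dots> = (\<Sum>j<k. real (card {i. i < n \<and> J i = j}) *\<^sub>R d j)"
      by (intro sum.cong refl) (simp add: sum_constant_scaleR)
    finally have "(1 / real n) *\<^sub>R (\<Sum>i<n. d (J i)) = (\<Sum>j<k. a j *\<^sub>R d j)"
      by (simp add: scaleR_sum_right a_def)
    then have "q ((1 / real n) *\<^sub>R (\<Sum>i<n. d (J i)) - (\<Sum>j<k. (real (h j) / real N) *\<^sub>R d j))
        = q (\<Sum>j<k. (a j - real (h j) / real N) *\<^sub>R d j)"
      by (simp add: sum_subtractf scaleR_diff_left)
    also have "\<dots> \<le> (\<Sum>j<k. q ((a j - real (h j) / real N) *\<^sub>R d j))" by (rule seminorm_sum[OF sq])
    also have "\<dots> \<le> (\<Sum>j<k. (1 / real N) * q (d j))"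
      unfolding seminorm_scale[OF sq] using ah by (intro sum_mono mult_right_mono seminorm_nonneg[OF sq]) auto
    also have "\<dots> = S / real N" by (simp add: S_def sum_divide_distrib)
    also have "\<dots> < e" by (rule N(2))
    finally have "q ((1 / real n) *\<^sub>R (\<Sum>i<n. d (J i)) - (\<Sum>j<k. (real (h j) / real N) *\<^sub>R d j)) < e" .
    moreover have "h \<in> {..<k} \<rightarrow>\<^sub>E {..N}" using ah(2) by (auto simp: h_def)
    ultimately show ?thesis unfolding Y_def by blast
  qed
  ultimately show ?thesis using that by blast
qed

text \<open>The \<open>n\<close>-th power of the truncated Laplace transform is an expectation over the event that all
  variables lie in the truncation set. There the mean is close to a finite net independent of \<open>n\<close>,
  so one point of the net carries an exponentially non-negligible part of it.\<close>

lemma truncated_laplace_hypograph: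
  fixes d :: "nat \<Rightarrow> 'a"
  assumes q: "admissible Cs q" and l: "l \<in> dualC Cs" and c: "\<And>v. \<bar>l v\<bar> \<le> c * q v" and c0: "c > 0"
    and e: "e > 0" "2 * e < r"
    and z: "z > 0" "ennreal z \<le> (\<integral>\<^sup>+\<omega>. ennreal (exp (l (X 0 \<omega>))) * indicator (\<Union>j<k. {y. q (y - d j) < e}) (X 0 \<omega>) \<partial>M)"
    and \<eta>: "\<eta> > 0"
  obtains y where "(y, ln z - l y - 2 * e * c - \<eta>) \<in> ball_hypograph q r"
proof -
  have sq: "seminorm q" using q by (simp add: admissible_def)
  have lin: "linear l" using l by (auto simp: dualC_def)
  define K where "K = (\<Union>j<k. {y. q (y - d j) < e})"
  have K: "K \<in> sets (FC Cs)" unfolding K_def by (intro sets.finite_UN ball_sets[OF q] finite_lessThan)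
  define h where "h y = ennreal (exp (l y)) * indicator K y" for y
  have h: "h \<in> borel_measurable (FC Cs)"
    unfolding h_def using measurable_dualC[OF l] K by measurable
  obtain Y where Y: "finite Y"
    "\<And>n J. n > 0 \<Longrightarrow> (\<And>i. i < n \<Longrightarrow> J i < k) \<Longrightarrow> \<exists>y\<in>Y. q ((1 / real n) *\<^sub>R (\<Sum>i<n. d (J i)) - y) < e"
    using mean_net[OF sq e(1)] by blast
  \<comment> \<open>Selecting one point of \<open>Y\<close> costs a factor \<open>card Y\<close>,
    which is below \<open>exp (m * \<eta>)\<close> for large \<open>m\<close>.\<close>
  obtain m where m: "m > 0" "real (card Y) < exp (real m * \<eta>)"
  proof -
    obtain m where "ln (real (card Y) + 1) / \<eta> < real m" using reals_Archimedean2 by blast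
    then have "ln (real (card Y) + 1) < real m * \<eta>" using \<eta> by (simp add: field_simps)
    then have 1: "real (card Y) + 1 < exp (real m * \<eta>)"
      by (metis add_nonneg_pos exp_less_cancel_iff exp_ln of_nat_0_le_iff zero_less_one)
    moreover have "m > 0"
    proof (rule ccontr)
      assume "\<not> m > 0"
      then show False using 1 by simp
    qed
    ultimately show ?thesis by (intro that[of m]) auto
  qed
  let ?E = "\<lambda>y. {\<omega>\<in>space M. q (mean X m \<omega> - y) < 2 * e}"
  have E: "?E y \<in> events" for y using mean_event[OF ball_sets[OF q, of y "2 * e"]] by simp
  \<comment> \<open>One \<open>e\<close> comes from replacing each variable by its centre
    \<open>d (J i)\<close>, the other from moving to the net. Off the truncation event the product
    vanishes.\<close>
  have bound: "(\<Prod>i<m. h (X i \<omega>)) \<le> (\<Sum>y\<in>Y. ennreal (exp (real m * (l y + 2 * e * c))) * indicator (?E y) \<omega>)"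
    if w: "\<omega> \<in> space M" for \<omega>
  proof (cases "\<forall>i<m. X i \<omega> \<in> K")
    case False
    then obtain i where "i < m" "h (X i \<omega>) = 0" by (auto simp: h_def)
    then have "(\<Prod>i<m. h (X i \<omega>)) = 0" by (intro prod_zero) auto
    then show ?thesis by (simp only: zero_le)
  next
    case True
    then have "\<forall>i. \<exists>j. i < m \<longrightarrow> j < k \<and> q (X i \<omega> - d j) < e" unfolding K_def by blast
    then obtain J where J: "\<And>i. i < m \<Longrightarrow> J i < k \<and> q (X i \<omega> - d (J i)) < e" by metis
    obtain y where y: "y \<in> Y" "q ((1 / real m) *\<^sub>R (\<Sum>i<m. d (J i)) - y) < e"
      using Y(2)[OF m(1), of J] J by blast
    have "q (mean X m \<omega> - (1 / real m) *\<^sub>R (\<Sum>i<m. d (J i))) = (1 / real m) * q (\<Sum>i<m. X i \<omega> - d (J i))"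
      unfolding mean_def by (simp add: seminorm_scale[OF sq] sum_subtractf flip: scaleR_diff_right)
    also have "\<dots> \<le> (1 / real m) * (\<Sum>i<m. q (X i \<omega> - d (J i)))"
      by (intro mult_left_mono seminorm_sum[OF sq]) simp
    also have "\<dots> \<le> (1 / real m) * (\<Sum>i<m. e)"
      using J by (intro mult_left_mono sum_mono) (auto simp: less_imp_le)
    also have "\<dots> = e" using m(1) by simp
    finally have near: "q (mean X m \<omega> - y) < 2 * e"
      using seminorm_triangle[OF sq, of "mean X m \<omega>" y "(1 / real m) *\<^sub>R (\<Sum>i<m. d (J i))"] y(2) by linarith
    have "(\<Prod>i<m. h (X i \<omega>)) = ennreal (exp (real m * l (mean X m \<omega>)))"
      using True m(1) by (simp add: h_def prod_ennreal exp_sum[symmetric] linear_mean[OF lin])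
    also have "\<dots> \<le> ennreal (exp (real m * (l y + 2 * e * c)))"
    proof -
      have "\<bar>l (mean X m \<omega>) - l y\<bar> \<le> c * q (mean X m \<omega> - y)"
        using c[of "mean X m \<omega> - y"] linear_diff[OF lin] by metis
      also have "\<dots> \<le> c * (2 * e)" using near c0 by (intro mult_left_mono) auto
      finally have "l (mean X m \<omega>) \<le> l y + 2 * e * c" by (simp add: mult_ac)
      then show ?thesis by (intro ennreal_leI) (simp add: mult_left_mono)
    qed
    also have "\<dots> = ennreal (exp (real m * (l y + 2 * e * c))) * indicator (?E y) \<omega>"
      using near w by simp
    also have "\<dots> \<le> (\<Sum>y\<in>Y. ennreal (exp (real m * (l y + 2 * e * c))) * indicator (?E y) \<omega>)"
      using Y(1) y(1) by (intro member_le_sum) auto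
    finally show ?thesis .
  qed
  have "ennreal z ^ m \<le> (\<integral>\<^sup>+\<omega>. h (X 0 \<omega>) \<partial>M) ^ m"
    using z(2) unfolding h_def K_def by (intro power_mono) auto
  also have "\<dots> = (\<integral>\<^sup>+\<omega>. (\<Prod>i<m. h (X i \<omega>)) \<partial>M)" by (rule nn_integral_prod_iid[OF h, symmetric])
  also have "\<dots> \<le> (\<integral>\<^sup>+\<omega>. (\<Sum>y\<in>Y. ennreal (exp (real m * (l y + 2 * e * c))) * indicator (?E y) \<omega>) \<partial>M)"
    by (intro nn_integral_mono bound)
  also have "\<dots> = (\<Sum>y\<in>Y. ennreal (exp (real m * (l y + 2 * e * c))) * emeasure M (?E y))"
    using E by (subst nn_integral_sum) (auto simp: nn_integral_cmult_indicator)
  also have "\<dots> = ennreal (\<Sum>y\<in>Y. exp (real m * (l y + 2 * e * c)) * prob (?E y))"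
    by (simp add: emeasure_eq_measure ennreal_mult[symmetric])
  finally have zm: "z ^ m \<le> (\<Sum>y\<in>Y. exp (real m * (l y + 2 * e * c)) * prob (?E y))"
    using z(1) by (simp add: ennreal_power ennreal_le_iff sum_nonneg)
  \<comment> \<open>If every point of the net failed, summing over \<open>Y\<close> would give
    \<open>z ^ m < z ^ m\<close>.\<close>
  have "\<exists>y\<in>Y. exp (real m * (ln z - l y - 2 * e * c - \<eta>)) \<le> prob (?E y)"
  proof (rule ccontr)
    assume neg: "\<not> ?thesis"
    have zexp: "z ^ m = exp (real m * ln z)" using z(1) by (simp add: exp_of_nat_mult)
    have "z ^ m \<le> (\<Sum>y\<in>Y. exp (real m * (l y + 2 * e * c)) * exp (real m * (ln z - l y - 2 * e * c - \<eta>)))"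
      using neg by (intro order.trans[OF zm] sum_mono mult_left_mono) (auto simp: not_le less_imp_le)
    also have "\<dots> = (\<Sum>y\<in>Y. z ^ m * exp (- (real m * \<eta>)))"
      unfolding zexp exp_add[symmetric] by (simp add: algebra_simps)
    also have "\<dots> = z ^ m * (real (card Y) * exp (- (real m * \<eta>)))" by simp
    also have "\<dots> < z ^ m * (exp (real m * \<eta>) * exp (- (real m * \<eta>)))"
      using m(2) z(1) by (intro mult_strict_left_mono mult_strict_right_mono) auto
    also have "\<dots> = z ^ m" by (simp flip: exp_add)
    finally show False by simp
  qed
  then obtain y where y: "exp (real m * (ln z - l y - 2 * e * c - \<eta>)) \<le> prob (?E y)" by blast
  \<comment> \<open>\<open>mean_ball_growth\<close> enlarges the radius strictly and the hypograph
    wants it below \<open>r\<close>; the midpoint of \<open>2 * e\<close> and \<open>r\<close> does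
    both.\<close>
  have "2 * e < (2 * e + r) / 2" "(2 * e + r) / 2 < r" using e(2) by auto
  with mean_ball_growth[OF q m(1) this(1) y] have "(y, ln z - l y - 2 * e * c - \<eta>) \<in> ball_hypograph q r"
    unfolding ball_hypograph_def by blast
  then show ?thesis by (rule that)
qed

text \<open>Separability exhausts the space by finite unions of balls of radius \<open>e\<close>.
  The truncated bound does not depend on the truncation, so monotone convergence passes it on to the
  full Laplace transform.\<close>

lemma laplace_le:
  assumes q: "admissible Cs q" and l: "l \<in> dualC Cs" and c: "\<And>v. \<bar>l v\<bar> \<le> c * q v" and c0: "c > 0"
    and e: "e > 0" "2 * e < r"
    and b: "\<And>y t. (y, t) \<in> ball_hypograph q r \<Longrightarrow> t + l y \<le> b"
  shows "(\<integral>\<^sup>+\<omega>. ennreal (exp (l (X 0 \<omega>))) \<partial>M) \<le> ennreal (exp (b + 2 * e * c))"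
proof -
  obtain D where D: "countable D" "\<And>x. \<exists>d\<in>D. q (x - d) < e"
    using q e(1) unfolding admissible_def separable_seminorm_def by blast
  define d where "d = from_nat_into D"
  have "D \<noteq> {}" using D(2) by blast
  then have ran: "range d = D" using D(1) unfolding d_def by (rule range_from_nat_into)
  define K where "K k = (\<Union>j<k. {y. q (y - d j) < e})" for k
  have K: "K k \<in> sets (FC Cs)" for k unfolding K_def by (intro sets.finite_UN ball_sets[OF q] finite_lessThan)
  define Z where "Z k = (\<integral>\<^sup>+\<omega>. ennreal (exp (l (X 0 \<omega>))) * indicator (K k) (X 0 \<omega>) \<partial>M)" for k
  have Zle: "Z k \<le> ennreal (exp (b + 2 * e * c))" for k
  proof (rule ccontr)
    assume "\<not> Z k \<le> ennreal (exp (b + 2 * e * c))"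
    then have lt: "ennreal (exp (b + 2 * e * c)) < Z k" by simp
    \<comment> \<open>\<open>truncated_laplace_hypograph\<close> takes the logarithm of a real
      number; should \<open>Z k\<close> be infinite, any real above the bound serves.\<close>
    obtain z where z: "exp (b + 2 * e * c) < z" "ennreal z \<le> Z k"
    proof (cases "Z k")
      case (real x)
      then show ?thesis using lt by (intro that[of x]) (auto simp: ennreal_less_iff)
    next
      case top
      then show ?thesis by (intro that[of "exp (b + 2 * e * c) + 1"]) auto
    qed
    have z0: "z > 0" using z(1) by (meson exp_gt_zero less_trans)
    have "ln z \<le> b + 2 * e * c + \<eta>" if \<eta>: "\<eta> > 0" for \<eta>
    proof -
      obtain y where "(y, ln z - l y - 2 * e * c - \<eta>) \<in> ball_hypograph q r"
        using truncated_laplace_hypograph[OF q l c c0 e z0 z(2)[unfolded Z_def K_def] \<eta>] by blast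
      from b[OF this] show ?thesis by simp
    qed
    then have "ln z \<le> b + 2 * e * c" by (rule field_le_epsilon)
    moreover have "b + 2 * e * c < ln z" using z(1) z0 by (metis exp_less_cancel_iff exp_ln)
    ultimately show False by simp
  qed
  have cover: "\<exists>k. y \<in> K k" for y
  proof -
    obtain j where "q (y - d j) < e" using D(2)[of y] ran by blast
    then have "y \<in> K (Suc j)" unfolding K_def by blast
    then show ?thesis ..
  qed
  have Kmono: "K k \<subseteq> K k'" if "k \<le> k'" for k k' using that by (force simp: K_def)
  have "(\<integral>\<^sup>+\<omega>. ennreal (exp (l (X 0 \<omega>))) \<partial>M)
      = (\<integral>\<^sup>+\<omega>. (SUP k. ennreal (exp (l (X 0 \<omega>))) * indicator (K k) (X 0 \<omega>)) \<partial>M)"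
  proof (rule nn_integral_cong)
    fix \<omega>
    let ?u = "ennreal (exp (l (X 0 \<omega>)))"
    obtain k where k: "X 0 \<omega> \<in> K k" using cover by blast
    show "?u = (SUP k. ?u * indicator (K k) (X 0 \<omega>))"
    proof (rule antisym)
      show "?u \<le> (SUP k. ?u * indicator (K k) (X 0 \<omega>))"
        using k by (intro SUP_upper2[of k]) auto
      show "(SUP k. ?u * indicator (K k) (X 0 \<omega>)) \<le> ?u"
        by (intro SUP_least) (auto simp: indicator_def)
    qed
  qed
  also have "\<dots> = (SUP k. Z k)"
    unfolding Z_def
  proof (rule nn_integral_monotone_convergence_SUP)
    show "incseq (\<lambda>k \<omega>. ennreal (exp (l (X 0 \<omega>))) * indicator (K k) (X 0 \<omega>))"
      using Kmono by (auto simp: incseq_def le_fun_def indicator_def)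
    fix k
    have "(\<lambda>y. ennreal (exp (l y)) * indicator (K k) y) \<in> borel_measurable (FC Cs)"
      using measurable_dualC[OF l] K by measurable
    from measurable_compose[OF hX this]
    show "(\<lambda>\<omega>. ennreal (exp (l (X 0 \<omega>))) * indicator (K k) (X 0 \<omega>)) \<in> borel_measurable M" .
  qed
  also have "\<dots> \<le> ennreal (exp (b + 2 * e * c))" by (rule SUP_least) (rule Zle)
  finally show ?thesis .
qed

section \<open>Lower bound for the entropy by separation\<close>

lemma pstar_nonneg: "0 \<le> pstar Cs M X x"
proof -
  have l: "(\<lambda>_. 0) \<in> dualC Cs" by (auto simp: dualC_def linear_zero)
  have "pressure M X (\<lambda>_. 0) = 0" by (simp add: pressure_def eln_def emeasure_space_1)
  then have "ereal 0 - pressure M X (\<lambda>_. 0) = 0" by simp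
  then show ?thesis unfolding pstar_def using SUP_upper[OF l, of "\<lambda>l. ereal (l x) - pressure M X l"] by simp
qed

lemma pstar_le_liminf_rate:
  assumes V: "V \<in> Cx Cs x"
  shows "- pstar Cs M X x \<le> liminf (rate M X V)"
proof (rule ccontr)
  assume "\<not> - pstar Cs M X x \<le> liminf (rate M X V)"
  then obtain t1 where t1: "liminf (rate M X V) < ereal t1" "ereal t1 < - pstar Cs M X x"
    using ereal_dense2[of "liminf (rate M X V)" "- pstar Cs M X x"] by (auto simp: not_le)
  \<comment> \<open>The gap \<open>t1 - t0\<close> will pay for the error \<open>2 * e * c\<close>
    of \<open>laplace_le\<close>.\<close>
  obtain t0 where t0: "liminf (rate M X V) < ereal t0" "t0 < t1"
    using ereal_dense2[OF t1(1)] by auto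
  have "- pstar Cs M X x \<le> 0" using pstar_nonneg[of x] by simp
  then have t1neg: "t1 < 0" using t1(2) by (metis ereal_less(2) less_le_trans zero_ereal_def less_ereal.simps(1))
  obtain q where q: "admissible Cs q" and Vq: "V = {y. q (y - x) < 1}"
    using Cx_seminorm_ball[OF hC V] by blast
  have sq: "seminorm q" using q by (simp add: admissible_def)
  \<comment> \<open>This slope gives \<open>t0 + c / 2 = 0\<close>: at distance 1/2 from
    \<open>x\<close> the cone-shaped bound \<open>t0 + c * q\<close> has reached 0, above which the
    hypograph has no points.\<close>
  define c where "c = - 2 * t0"
  have c0: "c > 0" using t0(2) t1neg by (simp add: c_def)
  \<comment> \<open>With \<open>3 * e \<le> 1 / 2\<close>, balls of radius \<open>3 * e\<close>
    around points within 1/2 of \<open>x\<close> stay in \<open>V\<close>; the other bound gives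
    \<open>2 * e * c \<le> t1 - t0\<close>. The radius \<open>3 * e\<close> exceeds the
    \<open>2 * e\<close> in \<open>laplace_le\<close>.\<close>
  define e where "e = min (1 / 6) ((t1 - t0) / (2 * c))"
  have e0: "e > 0" "3 * e \<le> 1 / 2" using t0(2) c0 by (auto simp: e_def)
  have "e \<le> (t1 - t0) / (2 * c)" by (simp add: e_def)
  then have ec: "2 * e * c \<le> t1 - t0" using c0 by (simp add: field_simps)
  \<comment> \<open>Moving \<open>(x, t0)\<close> to the origin gives the wanted estimate the form
    \<open>t \<le> c * q y\<close> of \<open>Mazur_Orlicz\<close>.\<close>
  define A where "A = (+) (- x, - t0) ` ball_hypograph q (3 * e)"
  have A: "convex A" unfolding A_def by (rule convex_translation[OF convex_ball_hypograph[OF q]])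
  have sub: "sublinear (\<lambda>v. c * q v)"
    unfolding sublinear_def
    using c0 by (auto simp: seminorm_scale[OF sq] seminorm_add[OF sq] distrib_left[symmetric])
  have le: "t \<le> c * q y" if "(y, t) \<in> A" for y t
  proof -
    have H: "(y + x, t + t0) \<in> ball_hypograph q (3 * e)" using that by (auto simp: A_def)
    show ?thesis
    proof (cases "q y \<le> 1 / 2")
      case True
      then have "q (y + x - x) + 3 * e \<le> 1" using e0(2) by simp
      from le_less_trans[OF ball_hypograph_le_liminf[OF q H this] t0(1)[unfolded Vq]]
      have "ereal (t + t0) < ereal t0" .
      then have "t \<le> 0" by simp
      then show ?thesis using c0 seminorm_nonneg[OF sq, of y] by (meson mult_nonneg_nonneg less_imp_le order.trans)
    next
      case False
      then have "c * (1 / 2) \<le> c * q y" using c0 by (intro mult_left_mono) auto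
      then show ?thesis using ball_hypograph_nonpos[OF H] by (simp add: c_def)
    qed
  qed
  obtain f where f: "linear f" "\<And>v. f v \<le> c * q v" "\<And>y t. (y, t) \<in> A \<Longrightarrow> t \<le> f y"
    using Mazur_Orlicz[OF sub A le] by blast
  \<comment> \<open>\<open>Mazur_Orlicz\<close> yields \<open>t \<le> f y\<close> on
    \<open>A\<close>; bounding \<open>t + l y\<close> from above calls for the opposite
    sign.\<close>
  define l where "l v = - f v" for v
  have lin: "linear l" unfolding l_def[abs_def] using f(1) by (rule linear_compose_neg)
  have lc: "\<bar>l v\<bar> \<le> c * q v" for v
    using f(2)[of v] f(2)[of "- v"] linear_neg[OF f(1), of v] seminorm_minus[OF sq, of v] by (simp add: l_def)
  have l: "l \<in> dualC Cs" by (rule dominated_dualC[OF q lin c0 lc])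
  have lb: "t + l y \<le> t0 + l x" if "(y, t) \<in> ball_hypograph q (3 * e)" for y t
  proof -
    have "(- x + y, - t0 + t) \<in> A" unfolding A_def using that by force
    then have "- t0 + t \<le> f (- x + y)" by (rule f(3))
    then show ?thesis using linear_add[OF f(1), of "- x" y] linear_neg[OF f(1), of x] by (simp add: l_def)
  qed
  have "(\<integral>\<^sup>+\<omega>. ennreal (exp (l (X 0 \<omega>))) \<partial>M) \<le> ennreal (exp (t0 + l x + 2 * e * c))"
    by (rule laplace_le[OF q l lc c0 e0(1) _ lb]) (use e0 in auto)
  then have "pressure M X l \<le> ereal (t0 + l x + 2 * e * c)"
    unfolding pressure_def by (rule eln_le)
  also have "\<dots> \<le> ereal (t1 + l x)" using ec by simp
  finally have "ereal (l x) - ereal (t1 + l x) \<le> ereal (l x) - pressure M X l"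
    by (intro ereal_minus_mono) auto
  also have "\<dots> \<le> pstar Cs M X x" unfolding pstar_def using l by (rule SUP_upper)
  finally have "ereal (- t1) \<le> pstar Cs M X x" by simp
  then have "- pstar Cs M X x \<le> ereal t1" by (simp add: ereal_uminus_le_reorder)
  then show False using t1(2) by simp
qed

lemma entropy_eq_pstar: "Defs.entropy Cs M X x = - pstar Cs M X x"
proof (rule antisym)
  show "- pstar Cs M X x \<le> Defs.entropy Cs M X x"
    unfolding Defs.entropy_def by (rule INF_greatest) (rule pstar_le_liminf_rate)
qed (rule entropy_le_pstar)

end

theorem theorem4p5:
  fixes Cs :: "'a::real_vector set set"
    and M :: "'b measure"
    and X :: "nat \<Rightarrow> 'b \<Rightarrow> 'a"
  assumes hC: "\<And>C. C \<in> Cs \<Longrightarrow> symmetric_set C \<and> alg_open C \<and> convex C \<and> 0 \<in> C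
                               \<and> separable_top (tau_single C)"
    and hM: "prob_space M"
    and hX: "\<And>i. X i \<in> measurable M (FC Cs)"
    and hind: "prob_space.indep_vars M (\<lambda>_. FC Cs) X UNIV"
    and hid: "\<And>i. distr M (FC Cs) (X i) = distr M (FC Cs) (X 0)"
  shows "weak_LDP Cs M X \<and> (\<forall>x. entropy Cs M X x = - pstar Cs M X x)"
proof -
  interpret prob_space M by (rule hM)
  interpret iid_sequence Cs M X
    by unfold_locales (fact hC, fact hX, fact hind, fact hid)
  show ?thesis
    using weak_LDP_lower weak_LDP_upper entropy_eq_pstar unfolding weak_LDP_def by blast
qed

end
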